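(* Let $d\ge 1$ be an integer, let $1<p\le 2$, and let $T\colon W^1_1(\mathbb{T}^d)\to L_p(\mathbb{T}^d)$ be a bounded linear translation invariant operator, with $(\lambda_n)_{n\in\mathbb{Z}^d}$ the complex sequence such that $\widehat{T(f)}(n)=\lambda_n\cdot\widehat{f}(n)$ for all $f\in W^1_1(\mathbb{T}^d)$ and $n\in\mathbb{Z}^d$. Then for any $\varepsilon>0$, $$\sum_{n\in\mathbb{Z}^d\setminus\{0\}}\left(\frac{|\lambda_n|}{|n|_2}\right)^{\frac{p}{p-1}+\frac{p}{p-1}(d+1)+\varepsilon}<\infty.$$
   Context: $\mathbb{T}^d=\mathbb{R}^d/\mathbb{Z}^d$ is the $d$-dimensional torus with normalized Haar measure, $\widehat{f}(n)$ ($n\in\mathbb{Z}^d$) are Fourier coefficients, and $|n|_2$ is the Euclidean norm of $n$. $W^1_1(\mathbb{T}^d)$ is the Sobolev space of (complex-valued) functions $f\in L_1(\mathbb{T}^d)$ whose first-order weak partial derivatives belong to $L_1(\mathbb{T}^d)$, with norm $\|f\|_{1,1}=\|f\|_1+\sum_{j=1}^d\left\|\frac{\partial f}{\partial x_j}\right\|_1$. Translation invariant means commuting with all translations of $\mathbb{T}^d$; equivalently, acting as the Fourier multiplier displayed in the claim. *)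

theory Defs
  imports "HOL-Analysis.Analysis"
begin

text \<open>
  Functions on the torus \<open>\<real>\<^sup>d / \<int>\<^sup>d\<close> are represented by \<open>\<int>\<^sup>d\<close>-periodic functions on
  \<open>real ^ 'd\<close>, where \<open>d = CARD('d) \<ge> 1\<close>. Elements of the function spaces are
  representatives; equality in these spaces is equality almost everywhere.
\<close>

definition of_int_vec :: "int ^ 'd \<Rightarrow> real ^ 'd" where
  "of_int_vec n = (\<chi> i. of_int (n $ i))"

definition periodic :: "(real ^ 'd \<Rightarrow> complex) \<Rightarrow> bool" where
  "periodic f \<longleftrightarrow> (\<forall>x n. f (x + of_int_vec n) = f x)"

text \<open>
  Integration against normalized Haar measure: the closed unit cube is a fundamental
  domain up to a null set and has measure 1.
\<close>

definition torus :: "(real ^ 'd) measure" where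
  "torus = restrict_space lborel (cbox 0 1)"

definition fourier_coeff :: "(real ^ 'd \<Rightarrow> complex) \<Rightarrow> int ^ 'd \<Rightarrow> complex" where
  "fourier_coeff f n = (LINT x|torus. f x * cis (- 2 * pi * (of_int_vec n \<bullet> x)))"

definition Lp :: "real \<Rightarrow> (real ^ 'd \<Rightarrow> complex) set" where
  "Lp p = {f. periodic f \<and> f \<in> borel_measurable borel \<and>
              integrable torus (\<lambda>x. norm (f x) powr p)}"

definition Lp_norm :: "real \<Rightarrow> (real ^ 'd \<Rightarrow> complex) \<Rightarrow> real" where
  "Lp_norm p f = (LINT x|torus. norm (f x) powr p) powr (1 / p)"

definition partial :: "'d \<Rightarrow> (real ^ 'd \<Rightarrow> complex) \<Rightarrow> real ^ 'd \<Rightarrow> complex" where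
  "partial j f x = frechet_derivative f (at x) (axis j 1)"

primrec Ck :: "nat \<Rightarrow> (real ^ 'd \<Rightarrow> complex) \<Rightarrow> bool" where
  "Ck 0 f \<longleftrightarrow> continuous_on UNIV f"
| "Ck (Suc k) f \<longleftrightarrow> (\<forall>x. f differentiable (at x)) \<and> (\<forall>j. Ck k (partial j f))"

definition test_function :: "(real ^ 'd \<Rightarrow> complex) \<Rightarrow> bool" where
  "test_function \<phi> \<longleftrightarrow> periodic \<phi> \<and> (\<forall>k. Ck k \<phi>)"

definition is_weak_partial ::
    "'d \<Rightarrow> (real ^ 'd \<Rightarrow> complex) \<Rightarrow> (real ^ 'd \<Rightarrow> complex) \<Rightarrow> bool" where
  "is_weak_partial j f g \<longleftrightarrow>
     (\<forall>\<phi>. test_function \<phi> \<longrightarrow>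
        (LINT x|torus. f x * partial j \<phi> x) = - (LINT x|torus. g x * \<phi> x))"

definition W11 :: "(real ^ 'd \<Rightarrow> complex) set" where
  "W11 = {f \<in> Lp 1. \<forall>j. \<exists>g \<in> Lp 1. is_weak_partial j f g}"

text \<open>Weak derivatives in \<open>L\<^sub>1\<close> are unique up to null sets, so the norm below does not depend on the choice.\<close>

definition weak_partial :: "'d \<Rightarrow> (real ^ 'd \<Rightarrow> complex) \<Rightarrow> real ^ 'd \<Rightarrow> complex" where
  "weak_partial j f = (SOME g. g \<in> Lp 1 \<and> is_weak_partial j f g)"

definition W11_norm :: "(real ^ 'd \<Rightarrow> complex) \<Rightarrow> real" where
  "W11_norm f = Lp_norm 1 f + (\<Sum>j\<in>UNIV. Lp_norm 1 (weak_partial j f))"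

text \<open>
  An operator on equivalence classes is given by a map on representatives which respects
  almost-everywhere equality and satisfies the operator identities almost everywhere.
\<close>

definition bounded_linear_W11_Lp ::
    "real \<Rightarrow> ((real ^ 'd \<Rightarrow> complex) \<Rightarrow> (real ^ 'd \<Rightarrow> complex)) \<Rightarrow> bool" where
  "bounded_linear_W11_Lp p T \<longleftrightarrow>
     (\<forall>f \<in> W11. T f \<in> Lp p) \<and>
     (\<forall>f \<in> W11. \<forall>g \<in> W11. (AE x in torus. f x = g x) \<longrightarrow> (AE x in torus. T f x = T g x)) \<and>
     (\<forall>f \<in> W11. \<forall>g \<in> W11. AE x in torus. T (\<lambda>y. f y + g y) x = T f x + T g x) \<and>
     (\<forall>c. \<forall>f \<in> W11. AE x in torus. T (\<lambda>y. c * f y) x = c * T f x) \<and>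
     (\<exists>C. \<forall>f \<in> W11. Lp_norm p (T f) \<le> C * W11_norm f)"

definition translation_invariant ::
    "((real ^ 'd \<Rightarrow> complex) \<Rightarrow> (real ^ 'd \<Rightarrow> complex)) \<Rightarrow> bool" where
  "translation_invariant T \<longleftrightarrow>
     (\<forall>a. \<forall>f \<in> W11. AE x in torus. T (\<lambda>y. f (y + a)) x = T f (x + a))"

end

theory Submission
  imports Defs
begin

text \<open>
  Put \<open>q = p / (p - 1)\<close>, \<open>d = CARD('d)\<close> and \<open>a n = \<bar>lam n\<bar> / \<bar>n\<bar>\<close>. It suffices to show that for \<open>t \<le> 1\<close> at most
  \<open>C t\<^bsup>-\<sigma>\<^esup>\<close> frequencies satisfy \<open>a n \<ge> t\<close>, with \<open>\<sigma>\<close> slightly above \<open>q (d + 2)\<close>. By a weak-type Hausdorff--Young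
  inequality, if \<open>f\<close> is a trigonometric polynomial and \<open>\<bar>lam n\<bar> \<bar>fourier_coeff f n\<bar> \<ge> s\<close> for all \<open>n \<in> A\<close>, then
  \<open>card A \<le> (C W11_norm f / s)\<^bsup>q\<^esup>\<close>. A de la Vallee Poussin kernel as \<open>f\<close> shows that every dyadic shell
  \<open>2\<^bsup>l\<^esup> \<le> \<bar>n\<bar> < 2\<^bsup>l+1\<^esup>\<close> contains \<open>O(t\<^bsup>-q\<^esup>)\<close> such frequencies. If \<open>M\<close> of these frequencies have directions within
  \<open>1 / M\<close> of each other and norms growing by factors \<open>4 M\<close>, then a primitive of a Riesz product over them is bounded in
  \<open>W11\<close> and has coefficients of size \<open>1 / \<bar>n\<bar>\<close> there, so \<open>M = O(t\<^bsup>-q\<^esup>)\<close>. Sorting the shells into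
  \<open>O(M\<^bsup>d\<^esup> log M)\<close> classes by direction and by level modulo \<open>O(log M)\<close> then bounds the number of shells involved by
  \<open>O(t\<^bsup>-q(d+1)\<^esup> log(1 / t))\<close>.
\<close>

subsection \<open>Integration over the torus\<close>

text \<open>A Riesz product has bounded L1 norm, but in the gradient of its primitive every term is
  multiplied by the unit vector of its own frequency, and for scattered directions the terms do not
  telescope. This dictates both tolerances: replacing each direction by the first one costs
  \<open>1 / M\<close> per term, and growth by \<open>4 M\<close> makes the terms in which the
  derivative hits an earlier factor cost \<open>O(1 / M)\<close> too, so that the \<open>M\<close>
  errors add up to a constant. The price is the number of direction classes; its exponent is
  \<open>d\<close> because \<open>cell\<close> rounds all \<open>d\<close> coordinates of the unit
  vector. With \<open>M\<close> of order \<open>t powr (- q)\<close>, the exponent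
  \<open>d + 2\<close> splits into \<open>d\<close> for the directions, 1 for the levels within a
  class and 1 for the frequencies within a level; the logarithm is paid out of
  \<open>\<epsilon>\<close>. Since only cardinalities matter, a pointwise Young inequality does the
  work of Hausdorff-Young, without interpolation. A separate obstacle is that
  \<open>W11_norm\<close> chooses some weak derivative: before it can be computed for a
  trigonometric polynomial, weak derivatives must be shown unique almost everywhere.\<close>

lemma sets_torus: "sets torus = sets (restrict_space borel (cbox 0 1))"
  by (simp add: torus_def sets_restrict_space)

lemma space_torus [simp]: "space (torus :: (real^'d) measure) = cbox 0 1"
  by (simp add: torus_def space_restrict_space)

lemma emeasure_torus: "emeasure (torus :: (real^'d) measure) (cbox 0 1) = 1"
proof -
  have "(0::real^'d) \<bullet> b \<le> 1 \<bullet> b" if "b \<in> Basis" for b :: "real^'d"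
    using that by (auto simp: Basis_vec_def inner_axis)
  moreover have "(\<Prod>b\<in>Basis. ((1::real^'d) - 0) \<bullet> b) = 1"
    by (intro prod.neutral) (auto simp: Basis_vec_def inner_axis)
  ultimately have "emeasure lborel (cbox (0::real^'d) 1) = 1"
    by (subst emeasure_lborel_cbox) auto
  thus ?thesis
    by (simp add: torus_def emeasure_restrict_space)
qed

lemma finite_measure_torus: "finite_measure (torus :: (real^'d) measure)"
  by (rule finite_measureI) (simp add: emeasure_torus)

lemma measure_torus [simp]: "measure (torus :: (real^'d) measure) (cbox 0 1) = 1"
  by (simp add: measure_def emeasure_torus)

lemma measurable_torus:
  "f \<in> borel_measurable borel \<Longrightarrow> f \<in> borel_measurable torus"
  unfolding torus_def by (intro measurable_restrict_space1) simp

lemma integrable_torus_bounded: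
  fixes f :: "real^'d \<Rightarrow> 'b::{banach,second_countable_topology}"
  assumes "f \<in> borel_measurable torus" "\<And>x. x \<in> cbox 0 1 \<Longrightarrow> norm (f x) \<le> B"
  shows "integrable torus f"
  by (rule finite_measure.integrable_const_bound[OF finite_measure_torus, of _ B])
     (use assms in auto)

lemma integrable_torus_continuous:
  fixes f :: "real^'d \<Rightarrow> 'b::{banach,second_countable_topology}"
  assumes "continuous_on UNIV f"
  shows "integrable torus f"
proof -
  have "compact (f ` cbox 0 1)"
    by (intro compact_continuous_image continuous_on_subset[OF assms]) auto
  then obtain B where "\<forall>y\<in>f ` cbox 0 1. norm y \<le> B"
    using compact_imp_bounded bounded_iff by metis
  thus ?thesis
    by (intro integrable_torus_bounded[of f B] measurable_torus borel_measurable_continuous_onI assms) auto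
qed

lemma integrable_torus_mult:
  fixes f :: "real^'d \<Rightarrow> complex"
  assumes "integrable torus f" "continuous_on UNIV g"
  shows "integrable torus (\<lambda>x. f x * g x)"
proof -
  have "compact (g ` cbox 0 1)"
    by (intro compact_continuous_image continuous_on_subset[OF assms(2)]) auto
  then obtain B where B: "\<forall>y\<in>g ` cbox 0 1. norm y \<le> B"
    using compact_imp_bounded bounded_iff by metis
  have [measurable]: "f \<in> borel_measurable torus" "g \<in> borel_measurable torus"
    using assms by (auto intro!: measurable_torus borel_measurable_continuous_onI)
  show ?thesis
  proof (rule Bochner_Integration.integrable_bound[where f = "\<lambda>x. B * norm (f x)"])
    show "integrable torus (\<lambda>x. B * norm (f x))" using assms(1) by (intro integrable_mult_right integrable_norm)
    show "AE x in torus. norm (f x * g x) \<le> norm (B * norm (f x))"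
    proof (rule AE_I2)
      fix x :: "real^'d" assume "x \<in> space torus"
      hence "norm (g x) \<le> B" using B by auto
      thus "norm (f x * g x) \<le> norm (B * norm (f x))"
        by (smt (verit) mult.commute mult_left_mono norm_ge_zero norm_mult real_norm_def)
    qed
  qed simp
qed

lemma integral_torus: 
  fixes f :: "real^'d \<Rightarrow> 'b::{banach,second_countable_topology}"
  shows "(LINT x|torus. f x) = (LINT x|lborel. indicator (cbox 0 1) x *\<^sub>R f x)"
  unfolding torus_def by (rule integral_restrict_space) simp

lemma integral_torus_mono:
  fixes f g :: "real^'d \<Rightarrow> real"
  assumes "continuous_on UNIV f" "continuous_on UNIV g" "\<And>x. f x \<le> g x"
  shows "(LINT x|torus. f x) \<le> (LINT x|torus. g x)"
  by (intro integral_mono integrable_torus_continuous assms)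

lemma mem_cbox_01: "x \<in> cbox (0::real^'d) 1 \<longleftrightarrow> (\<forall>i. 0 \<le> x $ i \<and> x $ i \<le> 1)"
  by (simp add: mem_box_cart)

lemma periodic_axis:
  fixes F :: "real^'d \<Rightarrow> complex"
  assumes "periodic F"
  shows "F (axis j 1 + z) = F z"
proof -
  have "of_int_vec (axis j 1) = (axis j 1 :: real^'d)"
    by (auto simp: of_int_vec_def vec_eq_iff axis_def)
  thus ?thesis using assms unfolding periodic_def by (metis add.commute)
qed

text \<open>By Fubini the \<open>j\<close>-th coordinate is integrated first; the fundamental
  theorem of calculus leaves a difference of values at opposite faces, which periodicity cancels.
  Both integration by parts and the orthogonality of characters rest on this.\<close>

lemma integral_partial_zero:
  fixes F :: "real^'d \<Rightarrow> complex"
  assumes per: "periodic F" and diff: "\<And>x. F differentiable (at x)"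
    and cont: "continuous_on UNIV (partial j F)"
  shows "(LINT x|torus. partial j F x) = 0"
proof -
  define i :: "real^'d" where "i = axis j 1"
  define I :: "(real^'d) set" where "I = Basis - {i}"
  have iB: "i \<in> Basis" by (auto simp: i_def Basis_vec_def)
  have BI: "Basis = insert i I" "finite I" "i \<notin> I" using iB by (auto simp: I_def)
  define g where "g x = indicator (cbox (0::real^'d) 1) x *\<^sub>R partial j F x" for x
  have gint: "integrable lborel g"
    using integrable_torus_continuous[OF cont] unfolding torus_def g_def
    by (subst (asm) integrable_restrict_space) auto
  interpret product_sigma_finite "\<lambda>b::real^'d. lborel :: real measure" ..
  \<comment> \<open>\<open>S\<close> assembles a vector from its coordinates and carries the product
    of one-dimensional Lebesgue measures to \<open>lborel\<close>; in this form a single coordinate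
    can be split off.\<close>
  define S where "S f = (\<Sum>b\<in>Basis. f b *\<^sub>R b)" for f :: "real^'d \<Rightarrow> real"
  have Sm: "S \<in> measurable (\<Pi>\<^sub>M b\<in>Basis. lborel) borel" unfolding S_def by measurable
  have lb: "(lborel :: (real^'d) measure) = distr (\<Pi>\<^sub>M b\<in>Basis. lborel) borel S"
    unfolding S_def by (rule lborel_eq)
  have gm: "g \<in> borel_measurable borel" using gint by auto
  have "(LINT x|torus. partial j F x) = (LINT x|lborel. g x)"
    by (simp add: integral_torus g_def)
  also have "\<dots> = (LINT f|(\<Pi>\<^sub>M b\<in>Basis. lborel). g (S f))"
    unfolding lb by (rule integral_distr[OF Sm gm])
  also have "\<dots> = (LINT f|PiM I (\<lambda>_. lborel). LINT y|lborel. g (S (f(i := y))))"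
    unfolding BI(1)
  proof (rule product_integral_insert[OF BI(2,3)])
    have "integrable (distr (\<Pi>\<^sub>M b\<in>Basis. lborel) borel S) g"
      using gint unfolding lb .
    thus "integrable (PiM (insert i I) (\<lambda>_. lborel)) (\<lambda>f. g (S f))"
      unfolding BI(1)[symmetric] using integrable_distr_eq[OF Sm gm] by simp
  qed
  also have "\<dots> = (LINT f|PiM I (\<lambda>_. lborel :: real measure). 0)"
  proof (rule Bochner_Integration.integral_cong[OF refl])
    fix f :: "real^'d \<Rightarrow> real"
    define z where "z = (\<Sum>b\<in>I. f b *\<^sub>R b)"
    have Sf: "S (f(i := y)) = y *\<^sub>R i + z" for y
    proof -
      have "(\<Sum>b\<in>I. (f(i := y)) b *\<^sub>R b) = z" unfolding z_def
        using BI(3) by (intro sum.cong) auto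
      thus ?thesis unfolding S_def BI(1) using BI(2,3) by simp
    qed
    have zj: "z $ j = 0"
    proof -
      have "b $ j = 0" if "b \<in> I" for b
        using that by (auto simp: I_def i_def Basis_vec_def axis_def)
      thus ?thesis by (simp add: z_def sum_component)
    qed
    \<comment> \<open>The indicator of the cube factors: along the line through \<open>z\<close> in
      direction \<open>i\<close> it is the indicator of the unit interval times the constant
      \<open>k\<close>, which tests the other coordinates.\<close>
    define k :: real where "k = (if \<forall>l. l \<noteq> j \<longrightarrow> 0 \<le> z $ l \<and> z $ l \<le> 1 then 1 else 0)"
    have ind: "indicator (cbox 0 1) (y *\<^sub>R i + z) = (indicator {0..1} y * k :: real)" for y
    proof -
      have "(y *\<^sub>R i + z) $ l = (if l = j then y else z $ l)" for l
        using zj by (auto simp: i_def axis_def)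
      thus ?thesis unfolding indicator_def mem_cbox_01 k_def by auto
    qed
    have der: "((\<lambda>y. F (y *\<^sub>R i + z)) has_vector_derivative partial j F (y *\<^sub>R i + z)) (at y)" for y
    proof -
      define x where "x = y *\<^sub>R i + z"
      have D: "(F has_derivative frechet_derivative F (at x)) (at x)"
        using diff frechet_derivative_works by blast
      have l: "((\<lambda>y. y *\<^sub>R i + z) has_derivative (\<lambda>h. h *\<^sub>R i)) (at y)"
        by (auto intro!: derivative_eq_intros)
      have "((\<lambda>y. F (y *\<^sub>R i + z)) has_derivative (\<lambda>h. frechet_derivative F (at x) (h *\<^sub>R i))) (at y)"
        using diff_chain_at[OF l D[unfolded x_def]] by (simp add: o_def x_def)
      moreover have "frechet_derivative F (at x) (h *\<^sub>R i) = h *\<^sub>R partial j F x" for h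
        using linear_frechet_derivative[OF diff] by (simp add: partial_def i_def linear_cmul)
      ultimately show ?thesis unfolding has_vector_derivative_def x_def by simp
    qed
    have "(LINT y|lborel. indicator {0..1} y *\<^sub>R partial j F (y *\<^sub>R i + z)) =
          F (1 *\<^sub>R i + z) - F (0 *\<^sub>R i + z)"
    proof (rule integral_FTC_Icc)
      show "continuous_on {0..1} (\<lambda>x. partial j F (x *\<^sub>R i + z))"
        by (intro continuous_on_compose2[OF cont] continuous_intros) auto
      show "((\<lambda>y. F (y *\<^sub>R i + z)) has_vector_derivative partial j F (x *\<^sub>R i + z)) (at x within {0..1})" for x
        using der has_vector_derivative_at_within by blast
    qed auto
    also have "\<dots> = 0" using periodic_axis[OF per, of j z] by (simp add: i_def)
    finally have 1: "(LINT y|lborel. indicator {0..1} y *\<^sub>R partial j F (y *\<^sub>R i + z)) = 0" .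
    have "(LINT y|lborel. g (S (f(i := y)))) =
          (LINT y|lborel. k *\<^sub>R (indicator {0..1} y *\<^sub>R partial j F (y *\<^sub>R i + z)))"
      unfolding Sf g_def ind by (simp add: mult.commute)
    also have "\<dots> = 0" unfolding integral_scaleR_right 1 by simp
    finally show "(LINT y|lborel. g (S (f(i := y)))) = 0" .
  qed
  finally show ?thesis by simp
qed

subsection \<open>Characters\<close>

definition tchar :: "int^'d \<Rightarrow> real^'d \<Rightarrow> complex" where
  "tchar n x = cis (2 * pi * (of_int_vec n \<bullet> x))"

lemma of_int_vec_add: "of_int_vec (m + n) = of_int_vec m + of_int_vec n"
  by (simp add: of_int_vec_def vec_eq_iff)

lemma of_int_vec_minus: "of_int_vec (- n) = - of_int_vec n"
  by (simp add: of_int_vec_def vec_eq_iff)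

lemma of_int_vec_diff: "of_int_vec (m - n) = of_int_vec m - of_int_vec n"
  by (simp add: of_int_vec_def vec_eq_iff)

lemma of_int_vec_0 [simp]: "of_int_vec 0 = 0"
  by (simp add: of_int_vec_def vec_eq_iff)

lemma of_int_vec_nth [simp]: "of_int_vec n $ i = of_int (n $ i)"
  by (simp add: of_int_vec_def)

lemma of_int_vec_eq_0_iff [simp]: "of_int_vec n = 0 \<longleftrightarrow> n = 0"
  by (simp add: of_int_vec_def vec_eq_iff)

lemma norm_of_int_vec_ge_1:
  assumes "n \<noteq> 0"
  shows "norm (of_int_vec n) \<ge> 1"
proof -
  obtain i where "n $ i \<noteq> 0" using assms by (auto simp: vec_eq_iff)
  hence "1 \<le> \<bar>of_int_vec n $ i\<bar>" by (simp; linarith)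
  also have "\<dots> \<le> norm (of_int_vec n)" by (rule component_le_norm_cart)
  finally show ?thesis .
qed

lemma tchar_0 [simp]: "tchar 0 x = 1"
  by (simp add: tchar_def)

lemma tchar_add: "tchar (m + n) x = tchar m x * tchar n x"
  by (simp add: tchar_def of_int_vec_add cis_mult algebra_simps inner_add_left)

lemma tchar_minus: "tchar (- n) x = cnj (tchar n x)"
  by (simp add: tchar_def of_int_vec_minus cis_cnj)

lemma norm_tchar [simp]: "norm (tchar n x) = 1"
  by (simp add: tchar_def)

lemma periodic_tchar: "periodic (tchar n)"
proof -
  have "tchar n (x + of_int_vec m) = tchar n x" for x m
  proof -
    have *: "of_int_vec n \<bullet> of_int_vec m = of_int (\<Sum>i\<in>UNIV. n $ i * m $ i)"
      by (simp add: inner_vec_def)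
    have "tchar n (x + of_int_vec m) = tchar n x * cis (2 * pi * of_int (\<Sum>i\<in>UNIV. n $ i * m $ i))"
      unfolding tchar_def inner_add_right * cis_mult by (simp add: algebra_simps)
    also have "cis (2 * pi * of_int (\<Sum>i\<in>UNIV. n $ i * m $ i)) = 1"
      by (rule cis_multiple_2pi) auto
    finally show ?thesis by simp
  qed
  thus ?thesis by (simp add: periodic_def)
qed

lemma continuous_tchar: "continuous_on UNIV (tchar n)"
  unfolding tchar_def by (intro continuous_intros)

lemma has_derivative_tchar:
  "(tchar n has_derivative (\<lambda>h. 2 * pi * \<i> * complex_of_real (of_int_vec n \<bullet> h) * tchar n x)) (at x)"
proof -
  have eq: "tchar n = (\<lambda>x. exp (\<i> * of_real (2 * pi * (of_int_vec n \<bullet> x))))"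
    by (auto simp: tchar_def cis_conv_exp)
  have i: "((\<lambda>x. \<i> * complex_of_real (2 * pi * (of_int_vec n \<bullet> x))) has_derivative
         (\<lambda>h. \<i> * complex_of_real (2 * pi * (of_int_vec n \<bullet> h)))) (at x)"
    by (auto intro!: derivative_eq_intros)
  have "(exp has_derivative (*) (exp z)) (at z)" for z :: complex
    using DERIV_exp[of z] by (simp add: has_field_derivative_def)
  from diff_chain_at[OF i this]
  show ?thesis unfolding eq o_def
    by (rule has_derivative_eq_rhs) (auto simp: algebra_simps)
qed

lemma tchar_differentiable: "tchar n differentiable (at x)"
  using has_derivative_tchar differentiable_def by blast

lemma inner_axis_1: "(v :: real^'d) \<bullet> axis j 1 = v $ j"
  by (simp add: inner_axis)

lemma partialI: "(f has_derivative D) (at x) \<Longrightarrow> partial j f x = D (axis j 1)"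
  by (metis frechet_derivative_at partial_def)

lemma partial_tchar: "partial j (tchar n) x = 2 * pi * \<i> * of_int (n $ j) * tchar n x"
  by (subst partialI[OF has_derivative_tchar]) (simp add: inner_axis_1)

lemma partial_linear_comb:
  assumes "f differentiable (at x)" "g differentiable (at x)"
  shows "partial j (\<lambda>x. c * f x + g x) x = c * partial j f x + partial j g x"
proof -
  have "((\<lambda>x. c * f x + g x) has_derivative (\<lambda>h. c * frechet_derivative f (at x) h + frechet_derivative g (at x) h)) (at x)"
    using assms frechet_derivative_works by (auto intro!: derivative_eq_intros)
  thus ?thesis by (subst partialI) (auto simp: partial_def)
qed

lemma partial_mult:
  assumes "f differentiable (at x)" "g differentiable (at x)"
  shows "partial j (\<lambda>x. f x * g x) x = f x * partial j g x + partial j f x * g x"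
proof -
  have "((\<lambda>x. f x * g x) has_derivative (\<lambda>h. f x * frechet_derivative g (at x) h + frechet_derivative f (at x) h * g x)) (at x)"
    using assms frechet_derivative_works by (auto intro!: derivative_eq_intros)
  thus ?thesis by (subst partialI) (auto simp: partial_def)
qed

subsection \<open>Trigonometric polynomials\<close>

text \<open>\<open>S\<close> only bounds the spectrum from above. Building the polynomial one
  character at a time makes every closure property a short induction and avoids normal forms; the
  bound on the spectrum is what later forces coefficients of Riesz products to vanish.\<close>

inductive trig_on :: "(int^'d) set \<Rightarrow> (real^'d \<Rightarrow> complex) \<Rightarrow> bool" for S where
  zero: "trig_on S (\<lambda>x. 0)"
| add_tchar: "n \<in> S \<Longrightarrow> trig_on S f \<Longrightarrow> trig_on S (\<lambda>x. c * tchar n x + f x)"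

lemma trig_on_mono: "trig_on S f \<Longrightarrow> S \<subseteq> S' \<Longrightarrow> trig_on S' f"
  by (induction rule: trig_on.induct) (auto intro: trig_on.intros)

lemma trig_on_add: "trig_on S f \<Longrightarrow> trig_on S g \<Longrightarrow> trig_on S (\<lambda>x. f x + g x)"
  by (induction rule: trig_on.induct) (auto simp: add.assoc intro: trig_on.intros)

lemma trig_on_cmult: "trig_on S f \<Longrightarrow> trig_on S (\<lambda>x. c * f x)"
proof (induction rule: trig_on.induct)
  case (add_tchar n f d)
  have "trig_on S (\<lambda>x. (c * d) * tchar n x + c * f x)"
    using add_tchar by (intro trig_on.add_tchar)
  thus ?case by (simp add: algebra_simps)
qed (auto intro: trig_on.intros)

lemma trig_on_tchar: "n \<in> S \<Longrightarrow> trig_on S (tchar n)"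
  using trig_on.add_tchar[OF _ trig_on.zero, of n S 1] by simp

lemma trig_on_const: "0 \<in> S \<Longrightarrow> trig_on S (\<lambda>x. c)"
  using trig_on.add_tchar[OF _ trig_on.zero, of 0 S c] by simp

lemma trig_on_sum: "(\<And>i. i \<in> A \<Longrightarrow> trig_on S (f i)) \<Longrightarrow> trig_on S (\<lambda>x. \<Sum>i\<in>A. f i x)"
  by (induction A rule: infinite_finite_induct) (auto intro: trig_on.zero trig_on_add)

lemma trig_on_mult:
  assumes "trig_on A f" "trig_on B g" "\<And>a b. a \<in> A \<Longrightarrow> b \<in> B \<Longrightarrow> a + b \<in> C"
  shows "trig_on C (\<lambda>x. f x * g x)"
  using assms(1)
proof (induction rule: trig_on.induct)
  case (add_tchar n f c)
  have "trig_on C (\<lambda>x. tchar n x * g x)"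
    using assms(2)
  proof (induction rule: trig_on.induct)
    case (add_tchar m g d)
    have "trig_on C (\<lambda>x. d * tchar (n + m) x + tchar n x * g x)"
      using add_tchar assms(3) \<open>n \<in> A\<close> by (intro trig_on.add_tchar) auto
    thus ?case by (simp add: algebra_simps tchar_add)
  qed (auto intro: trig_on.zero)
  from trig_on_add[OF trig_on_cmult[OF this] add_tchar.IH]
  show ?case by (simp add: algebra_simps)
qed (auto intro: trig_on.zero)

lemma trig_on_UNIV_mult:
  "trig_on UNIV f \<Longrightarrow> trig_on UNIV g \<Longrightarrow> trig_on UNIV (\<lambda>x. f x * g x)"
  by (rule trig_on_mult) auto

lemma trig_on_power: "trig_on UNIV f \<Longrightarrow> trig_on UNIV (\<lambda>x. f x ^ k)"
  by (induction k) (auto intro: trig_on_const trig_on_UNIV_mult)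

lemma trig_on_prod:
  "(\<And>i. i \<in> A \<Longrightarrow> trig_on UNIV (f i)) \<Longrightarrow> trig_on UNIV (\<lambda>x. \<Prod>i\<in>A. f i x)"
  by (induction A rule: infinite_finite_induct) (auto intro: trig_on_const trig_on_UNIV_mult)

lemma trig_on_cnj:
  "trig_on S f \<Longrightarrow> trig_on (uminus ` S) (\<lambda>x. cnj (f x))"
proof (induction rule: trig_on.induct)
  case (add_tchar n f c)
  have "trig_on (uminus ` S) (\<lambda>x. cnj c * tchar (-n) x + cnj (f x))"
    using add_tchar by (intro trig_on.add_tchar) auto
  thus ?case by (simp add: tchar_minus)
qed (auto intro: trig_on.zero)

lemma trig_on_periodic: "trig_on S f \<Longrightarrow> periodic f"
proof (induction rule: trig_on.induct)
  case (add_tchar n f c)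
  thus ?case using periodic_tchar[of n] by (simp add: periodic_def)
qed (simp add: periodic_def)

lemma trig_on_continuous: "trig_on S f \<Longrightarrow> continuous_on UNIV f"
  by (induction rule: trig_on.induct) (auto intro!: continuous_intros continuous_tchar)

lemma trig_on_differentiable: "trig_on S f \<Longrightarrow> f differentiable (at x)"
proof (induction rule: trig_on.induct)
  case (add_tchar n f c)
  thus ?case by (intro derivative_intros tchar_differentiable)
qed auto

lemma trig_on_partial: "trig_on S f \<Longrightarrow> trig_on S (partial j f)"
proof (induction rule: trig_on.induct)
  case zero
  have "partial j (\<lambda>x. 0) = (\<lambda>x. 0)"
    by (auto simp: partialI[OF has_derivative_const])
  thus ?case by (auto intro: trig_on.zero)
next
  case (add_tchar n f c)
  have "partial j (\<lambda>x. c * tchar n x + f x) x = (c * (2 * pi * \<i> * of_int (n $ j))) * tchar n x + partial j f x" for x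
    by (subst partial_linear_comb[OF tchar_differentiable trig_on_differentiable[OF add_tchar(2)]])
       (simp add: partial_tchar)
  thus ?case using trig_on.add_tchar[OF add_tchar(1,3), of "c * (2 * pi * \<i> * of_int (n $ j))"]
    by presburger
qed

lemma trig_on_Ck: "trig_on S f \<Longrightarrow> Ck k f"
  by (induction k arbitrary: f) (auto intro: trig_on_continuous trig_on_differentiable trig_on_partial)

lemma trig_on_test_function: "trig_on S f \<Longrightarrow> test_function f"
  by (simp add: test_function_def trig_on_periodic trig_on_Ck)

lemma trig_on_Lp_1:
  assumes "trig_on S f"
  shows "f \<in> Lp 1"
  using trig_on_periodic[OF assms] trig_on_continuous[OF assms]
  by (auto simp: Lp_def intro!: borel_measurable_continuous_onI integrable_torus_continuous continuous_intros)

text \<open>Integration by parts: the product with a test function is periodic and continuously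
  differentiable, so its partial derivative has integral zero.\<close>

lemma trig_on_weak_partial:
  assumes "trig_on S f"
  shows "is_weak_partial j f (partial j f)"
  unfolding is_weak_partial_def
proof (intro allI impI)
  fix \<phi> :: "real^'a \<Rightarrow> complex" assume "test_function \<phi>"
  hence per: "periodic \<phi>" and ck: "Ck k \<phi>" for k by (auto simp: test_function_def)
  have d: "\<phi> differentiable (at x)" for x using ck[of 1] by simp
  have c: "continuous_on UNIV \<phi>" "continuous_on UNIV (partial j \<phi>)"
    using ck[of 0] ck[of 1] by auto
  note df = trig_on_differentiable[OF assms]
  note cf = trig_on_continuous[OF assms] trig_on_continuous[OF trig_on_partial[OF assms]]
  have eq: "partial j (\<lambda>x. f x * \<phi> x) = (\<lambda>x. f x * partial j \<phi> x + partial j f x * \<phi> x)"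
    by (rule ext) (rule partial_mult[OF df d])
  have "(LINT x|torus. partial j (\<lambda>x. f x * \<phi> x) x) = 0"
  proof (rule integral_partial_zero)
    show "periodic (\<lambda>x. f x * \<phi> x)"
      using per trig_on_periodic[OF assms] by (simp add: periodic_def)
    show "(\<lambda>x. f x * \<phi> x) differentiable (at x)" for x by (intro derivative_intros df d)
    show "continuous_on UNIV (partial j (\<lambda>x. f x * \<phi> x))"
      unfolding eq by (intro continuous_intros c cf)
  qed
  also have "(LINT x|torus. partial j (\<lambda>x. f x * \<phi> x) x) =
      (LINT x|torus. f x * partial j \<phi> x) + (LINT x|torus. partial j f x * \<phi> x)"
    unfolding eq by (intro Bochner_Integration.integral_add integrable_torus_continuous continuous_intros c cf)
  finally show "(LINT x|torus. f x * partial j \<phi> x) = - (LINT x|torus. partial j f x * \<phi> x)"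
    by (simp add: eq_neg_iff_add_eq_0)
qed

lemma trig_on_W11: "trig_on S f \<Longrightarrow> f \<in> W11"
  using trig_on_Lp_1 trig_on_partial trig_on_weak_partial by (fastforce simp: W11_def)

text \<open>If \<open>n $ j\<close> is nonzero, the character is a nonzero multiple of its own
  \<open>j\<close>-th partial derivative, whose integral vanishes.\<close>

lemma integral_tchar: "(LINT x|torus. tchar n x) = (if n = 0 then 1 else 0)"
proof (cases "n = 0")
  case False
  then obtain j where j: "n $ j \<noteq> 0" by (auto simp: vec_eq_iff)
  have t: "trig_on UNIV (tchar n)" by (intro trig_on_tchar) auto
  have "(LINT x|torus. partial j (tchar n) x) = 0"
    by (intro integral_partial_zero periodic_tchar tchar_differentiable trig_on_continuous[OF trig_on_partial[OF t]])
  hence "(LINT x|torus. (2 * pi * \<i> * of_int (n $ j)) * tchar n x) = 0"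
    unfolding partial_tchar .
  hence "(2 * pi * \<i> * of_int (n $ j)) * (LINT x|torus. tchar n x) = 0"
    unfolding integral_mult_right_zero .
  thus ?thesis using j False by simp
qed simp

lemma fourier_coeff_eq_tchar: "fourier_coeff f n = (LINT x|torus. f x * tchar (- n) x)"
  by (simp add: fourier_coeff_def tchar_def of_int_vec_minus)

lemma fourier_coeff_tchar: "fourier_coeff (tchar m) n = (if m = n then 1 else 0)"
  unfolding fourier_coeff_eq_tchar tchar_add[symmetric] integral_tchar by simp

lemma fourier_coeff_linear_comb:
  assumes "continuous_on UNIV f" "continuous_on UNIV g"
  shows "fourier_coeff (\<lambda>x. c * f x + g x) n = c * fourier_coeff f n + fourier_coeff g n"
proof -
  have "fourier_coeff (\<lambda>x. c * f x + g x) n =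
     (LINT x|torus. c * (f x * tchar (- n) x) + g x * tchar (- n) x)"
    unfolding fourier_coeff_eq_tchar by (simp add: algebra_simps)
  also have "\<dots> = (LINT x|torus. c * (f x * tchar (- n) x)) + (LINT x|torus. g x * tchar (- n) x)"
    by (intro Bochner_Integration.integral_add integrable_torus_continuous continuous_intros assms continuous_tchar)
  finally show ?thesis unfolding fourier_coeff_eq_tchar by simp
qed

lemma fourier_coeff_add:
  assumes "continuous_on UNIV f" "continuous_on UNIV g"
  shows "fourier_coeff (\<lambda>x. f x + g x) n = fourier_coeff f n + fourier_coeff g n"
  using fourier_coeff_linear_comb[OF assms, of 1] by simp

lemma fourier_coeff_cmult:
  "fourier_coeff (\<lambda>x. c * f x) n = c * fourier_coeff f n"
  unfolding fourier_coeff_eq_tchar by (simp add: mult.assoc)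

lemma fourier_coeff_tchar_mult:
  "fourier_coeff (\<lambda>x. tchar m x * f x) n = fourier_coeff f (n - m)"
proof -
  have "tchar m x * f x * tchar (-n) x = f x * tchar (- (n - m)) x" for x
    using tchar_add[of m "-n" x] by (simp add: mult.commute)
  thus ?thesis unfolding fourier_coeff_eq_tchar by presburger
qed

lemma fourier_coeff_outside:
  assumes "trig_on S f" "n \<notin> S"
  shows "fourier_coeff f n = 0"
  using assms
proof (induction rule: trig_on.induct)
  case zero
  show ?case by (simp add: fourier_coeff_def)
next
  case (add_tchar m f c)
  have "fourier_coeff (\<lambda>x. c * tchar m x + f x) n = c * fourier_coeff (tchar m) n + fourier_coeff f n"
    by (intro fourier_coeff_linear_comb continuous_tchar trig_on_continuous[OF add_tchar(2)])
  thus ?case using add_tchar by (auto simp: fourier_coeff_tchar)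
qed

subsection \<open>Uniqueness of weak derivatives\<close>

text \<open>Opposite faces of the cube are the same points of the torus, so periodic functions
  cannot approximate indicators of boxes there; discarding the null boundary removes the
  problem.\<close>

lemma AE_torus_box: "AE x in (torus :: (real^'d) measure). x \<in> box 0 1"
proof -
  let ?c = "cbox (0::real^'d) 1" and ?b = "box (0::real^'d) 1"
  have B: "(0::real^'d) \<bullet> b \<le> 1 \<bullet> b" if "b \<in> Basis" for b :: "real^'d"
    using that by (auto simp: Basis_vec_def inner_axis)
  have "emeasure lborel (?c - ?b) = emeasure lborel ?c - emeasure lborel ?b"
    by (intro emeasure_Diff) (auto simp: box_subset_cbox emeasure_lborel_box_eq)
  also have "\<dots> = 0" using B by (simp add: emeasure_lborel_cbox emeasure_lborel_box)
  finally have "?c - ?b \<in> null_sets lborel" by (intro null_setsI) auto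
  hence "AE x in lborel. x \<notin> ?c - ?b" by (rule AE_not_in)
  hence "AE x in lborel. x \<in> ?c \<longrightarrow> x \<in> ?b" by eventually_elim auto
  thus ?thesis unfolding torus_def by (subst AE_restrict_space_iff) auto
qed

text \<open>Polynomials are wanted because a polynomial in a trigonometric polynomial is again one.
  Steep continuous ramps converge to the indicator, and Bernstein polynomials follow the
  \<open>m\<close>-th ramp up to \<open>1 / (m + 1)\<close>; the uniform bound 2 permits dominated
  convergence.\<close>

lemma bernstein_indicator_approx:
  fixes s :: real
  obtains N :: "nat \<Rightarrow> nat" and a :: "nat \<Rightarrow> nat \<Rightarrow> real" where
    "\<And>m u. u \<in> {0..1} \<Longrightarrow> \<bar>\<Sum>k\<le>N m. a m k * Bernstein (N m) k u\<bar> \<le> 2"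
    "\<And>u. u \<in> {0..1} \<Longrightarrow> (\<lambda>m. \<Sum>k\<le>N m. a m k * Bernstein (N m) k u) \<longlonglongrightarrow> (if u < s then 1 else 0)"
proof -
  \<comment> \<open>The ramp is zero at and beyond \<open>s\<close>, and 1 at every
    \<open>u < s\<close> once \<open>m\<close> is large, so the limit is the indicator of the strict
    inequality.\<close>
  define \<psi> where "\<psi> m u = min 1 (max 0 (real m * (s - u)))" for m u
  have "\<exists>N. \<forall>u\<in>{0..1}. \<bar>\<psi> m u - (\<Sum>k\<le>N. \<psi> m (k/N) * Bernstein N k u)\<bar> < 1 / (real m + 1)" for m
  proof -
    have "continuous_on {0..1} (\<psi> m)" unfolding \<psi>_def by (intro continuous_intros)
    from Bernstein_Weierstrass[OF this, of "1 / (real m + 1)"]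
    obtain N where "\<forall>n u. N \<le> n \<and> u \<in> {0..1} \<longrightarrow>
        \<bar>\<psi> m u - (\<Sum>k\<le>n. \<psi> m (k/n) * Bernstein n k u)\<bar> < 1 / (real m + 1)"
      by auto
    thus ?thesis by blast
  qed
  then obtain N where N: "\<And>m u. u \<in> {0..1} \<Longrightarrow>
      \<bar>\<psi> m u - (\<Sum>k\<le>N m. \<psi> m (k/N m) * Bernstein (N m) k u)\<bar> < 1 / (real m + 1)"
    by metis
  show ?thesis
  proof (rule that[of "\<lambda>m k. \<psi> m (k / N m)" N])
    fix m u assume u: "u \<in> {0..1::real}"
    have "\<bar>\<psi> m u\<bar> \<le> 1" by (auto simp: \<psi>_def)
    moreover have "1 / (real m + 1) \<le> 1" by simp
    ultimately show "\<bar>\<Sum>k\<le>N m. \<psi> m (k/N m) * Bernstein (N m) k u\<bar> \<le> 2"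
      using N[OF u, of m] by linarith
  next
    fix u assume u: "u \<in> {0..1::real}"
    have "(\<lambda>m. \<psi> m u) \<longlonglongrightarrow> (if u < s then 1 else 0)"
    proof (cases "u < s")
      case True
      have "eventually (\<lambda>m. real m \<ge> 1 / (s - u)) sequentially"
        using filterlim_real_sequentially by (simp add: filterlim_at_top)
      hence "eventually (\<lambda>m. \<psi> m u = 1) sequentially"
        by eventually_elim (use True in \<open>auto simp: \<psi>_def field_simps\<close>)
      thus ?thesis using True by (auto intro: tendsto_eventually)
    next
      case False
      hence "real m * (s - u) \<le> 0" for m by (simp add: mult_le_0_iff)
      hence "\<psi> m u = 0" for m by (simp add: \<psi>_def max_absorb1)
      thus ?thesis using False by simp
    qed
    moreover have "(\<lambda>m. (\<Sum>k\<le>N m. \<psi> m (k/N m) * Bernstein (N m) k u) - \<psi> m u) \<longlonglongrightarrow> 0"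
    proof (rule Lim_null_comparison)
      show "\<forall>\<^sub>F m in sequentially. norm ((\<Sum>k\<le>N m. \<psi> m (k/N m) * Bernstein (N m) k u) - \<psi> m u) \<le> 1 / (real m + 1)"
        using N[OF u] by (auto simp: abs_minus_commute intro!: always_eventually less_imp_le)
      show "(\<lambda>m. 1 / (real m + 1)) \<longlonglongrightarrow> 0"
        using LIMSEQ_inverse_real_of_nat by (simp add: inverse_eq_divide add.commute)
    qed
    ultimately show "(\<lambda>m. \<Sum>k\<le>N m. \<psi> m (k/N m) * Bernstein (N m) k u) \<longlonglongrightarrow> (if u < s then 1 else 0)"
      using tendsto_add by fastforce
  qed
qed

text \<open>An interval inside the unit interval is an arc of the circle, and the cosine is
  decreasing in the distance to its centre. The conditions on \<open>r\<close> and \<open>c\<close>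
  keep the arc from wrapping around, so membership in it becomes a condition on one trigonometric
  polynomial.\<close>

lemma cos_arc_iff:
  fixes y c r :: real
  assumes "0 < y" "y < 1" "0 < r" "r \<le> c" "r \<le> 1 - c"
  shows "cos (2 * pi * r) < cos (2 * pi * (y - c)) \<longleftrightarrow> \<bar>y - c\<bar> < r"
proof -
  have mono: "cos (2 * pi * r) < cos (2 * pi * z) \<longleftrightarrow> z < r" if "0 \<le> z" "z \<le> 1/2" for z
    using that assms cos_mono_less_eq[of "2 * pi * r" "2 * pi * z"] by (simp add: mult_le_cancel_left1)
  have ev: "cos (2 * pi * (y - c)) = cos (2 * pi * \<bar>y - c\<bar>)"
  proof -
    have "2 * pi * \<bar>y - c\<bar> = \<bar>2 * pi * (y - c)\<bar>" by (simp add: abs_mult)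
    thus ?thesis by (simp only: cos_abs_real)
  qed
  show ?thesis
  proof (cases "\<bar>y - c\<bar> \<le> 1/2")
    case True
    thus ?thesis using mono[of "\<bar>y - c\<bar>"] ev by simp
  next
    case False
    \<comment> \<open>Here the shorter way round the circle has length
      \<open>1 - \<bar>y - c\<bar>\<close>, which still exceeds \<open>r\<close> because
      \<open>y\<close> lies strictly between 0 and 1.\<close>
    have "cos (2 * pi * \<bar>y - c\<bar>) = cos (2 * pi * (1 - \<bar>y - c\<bar>))"
      by (simp add: right_diff_distrib cos_diff)
    moreover have "\<not> 1 - \<bar>y - c\<bar> < r" using assms by linarith
    ultimately show ?thesis using mono[of "1 - \<bar>y - c\<bar>"] ev False assms by auto
  qed
qed

lemma trig_on_cos_coordinate:
  "trig_on UNIV (\<lambda>x :: real^'d. complex_of_real ((1 - cos (2 * pi * (x $ j - c))) / 2))"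
proof -
  let ?n = "axis j 1 :: int^'d"
  have n: "of_int_vec ?n = axis j 1" by (simp add: of_int_vec_def vec_eq_iff axis_def)
  have c: "complex_of_real (cos t) = (cis t + cnj (cis t)) / 2" for t
    by (simp add: complex_eq_iff)
  have s: "cis (2 * pi * (x $ j - c)) = cis (- 2 * pi * c) * tchar ?n x" for x
    unfolding tchar_def n cis_mult by (simp add: inner_axis' algebra_simps)
  have "complex_of_real ((1 - cos (2 * pi * (x $ j - c))) / 2) =
      1 / 2 + (- cis (- 2 * pi * c) / 4 * tchar ?n x + (- cnj (cis (- 2 * pi * c)) / 4) * tchar (- ?n) x)" for x
    unfolding of_real_divide of_real_diff c s tchar_minus by (simp add: field_simps)
  moreover have "trig_on UNIV (\<lambda>x. 1 / 2 + (- cis (- 2 * pi * c) / 4 * tchar ?n x + (- cnj (cis (- 2 * pi * c)) / 4) * tchar (- ?n) x))"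
    by (intro trig_on_add trig_on_cmult trig_on_const trig_on_tchar) auto
  ultimately show ?thesis by presburger
qed

lemma trig_on_Bernstein:
  assumes "trig_on UNIV (\<lambda>x. complex_of_real (u x))"
  shows "trig_on UNIV (\<lambda>x. complex_of_real (\<Sum>k\<le>N. a k * Bernstein N k (u x)))"
proof -
  have eq: "complex_of_real (\<Sum>k\<le>N. a k * Bernstein N k (u x)) =
     (\<Sum>k\<le>N. of_real (a k * real (N choose k)) * (complex_of_real (u x) ^ k * (1 + (- 1) * complex_of_real (u x)) ^ (N - k)))" for x
    by (simp add: Bernstein_def mult.assoc)
  show ?thesis unfolding eq
    by (intro trig_on_sum trig_on_cmult trig_on_UNIV_mult trig_on_power trig_on_add trig_on_const assms) auto
qed

text \<open>Almost everywhere in the cube, the indicator of the box is a bounded limit of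
  trigonometric polynomials: a product over the coordinates of Bernstein approximations, each
  evaluated at \<open>(1 - cos (2 * pi * (x $ j - c j))) / 2\<close>. Dominated convergence passes
  the orthogonality to the limit.\<close>

lemma integral_box_zero:
  fixes h :: "real^'d \<Rightarrow> complex"
  assumes h: "integrable torus h"
    and orth: "\<And>\<phi>. trig_on UNIV \<phi> \<Longrightarrow> (LINT x|torus. h x * \<phi> x) = 0"
  shows "(LINT x|torus. indicator (box a b) x *\<^sub>R h x) = 0"
proof -
  \<comment> \<open>Clipping the box to the unit cube leaves the integral unchanged and makes every
    side an arc that does not wrap.\<close>
  define a' where "a' j = max (a $ j) 0" for j
  define b' where "b' j = min (b $ j) 1" for j
  have ab: "x \<in> box a b \<longleftrightarrow> (\<forall>j. a' j < x $ j \<and> x $ j < b' j)" if "x \<in> box 0 1" for x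
    using that by (auto simp: mem_box_cart a'_def b'_def)
  show ?thesis
  proof (cases "\<forall>j. a' j < b' j")
    case False
    then obtain j where "b' j \<le> a' j" by (auto simp: not_less)
    hence "x \<notin> box a b" if "x \<in> box 0 1" for x
      using ab[OF that] by (smt (verit))
    hence "AE x in torus. indicator (box a b) x *\<^sub>R h x = 0"
      using AE_torus_box by (auto elim!: eventually_mono simp: indicator_def)
    thus ?thesis by (rule integral_eq_zero_AE)
  next
    case True
    define c where "c j = (a' j + b' j) / 2" for j
    define r where "r j = (b' j - a' j) / 2" for j
    have cr: "0 < r j" "r j \<le> c j" "r j \<le> 1 - c j" for j
      using True[rule_format, of j] by (auto simp: c_def r_def field_simps a'_def b'_def)
    define s where "s j = (1 - cos (2 * pi * r j)) / 2" for j
    define u where "u j x = (1 - cos (2 * pi * (x $ j - c j))) / 2" for j and x :: "real^'d"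
    have u01: "u j x \<in> {0..1}" for j x
    proof -
      have "-1 \<le> cos (2 * pi * (x $ j - c j))" "cos (2 * pi * (x $ j - c j)) \<le> 1"
        by (rule cos_ge_minus_one, rule cos_le_one)
      thus ?thesis unfolding u_def by simp
    qed
    have tu: "trig_on UNIV (\<lambda>x. complex_of_real (u j x))" for j
      unfolding u_def by (rule trig_on_cos_coordinate)
    have ius: "x \<in> box a b \<longleftrightarrow> (\<forall>j. u j x < s j)" if "x \<in> box 0 1" for x
    proof -
      have "u j x < s j \<longleftrightarrow> a' j < x $ j \<and> x $ j < b' j" for j
      proof -
        have "u j x < s j \<longleftrightarrow> cos (2 * pi * r j) < cos (2 * pi * (x $ j - c j))"
          by (auto simp: u_def s_def)
        also have "\<dots> \<longleftrightarrow> \<bar>x $ j - c j\<bar> < r j"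
          using that cr[of j] by (intro cos_arc_iff) (auto simp: mem_box_cart)
        also have "\<dots> \<longleftrightarrow> a' j < x $ j \<and> x $ j < b' j"
          unfolding c_def r_def abs_less_iff by (auto simp: field_simps)
        finally show ?thesis .
      qed
      thus ?thesis using ab[OF that] by simp
    qed
    define good :: "'d \<Rightarrow> (nat \<Rightarrow> real \<Rightarrow> real) \<Rightarrow> bool" where "good j Q \<longleftrightarrow>
        (\<forall>m. \<forall>u\<in>{0..1}. \<bar>Q m u\<bar> \<le> 2) \<and>
        (\<forall>u\<in>{0..1}. (\<lambda>m. Q m u) \<longlonglongrightarrow> (if u < s j then 1 else 0)) \<and>
        (\<forall>m v. trig_on UNIV (\<lambda>x::real^'d. complex_of_real (v x)) \<longrightarrow> trig_on UNIV (\<lambda>x. complex_of_real (Q m (v x))))" for j Q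
    have "\<exists>Q. good j Q" for j
    proof (rule bernstein_indicator_approx[of "s j"])
      fix N :: "nat \<Rightarrow> nat" and a :: "nat \<Rightarrow> nat \<Rightarrow> real"
      assume *: "\<And>m u. u \<in> {0..1} \<Longrightarrow> \<bar>\<Sum>k\<le>N m. a m k * Bernstein (N m) k u\<bar> \<le> 2"
        "\<And>u. u \<in> {0..1} \<Longrightarrow> (\<lambda>m. \<Sum>k\<le>N m. a m k * Bernstein (N m) k u) \<longlonglongrightarrow> (if u < s j then 1 else 0)"
      have "good j (\<lambda>m u. \<Sum>k\<le>N m. a m k * Bernstein (N m) k u)"
        unfolding good_def by (intro conjI ballI allI impI * trig_on_Bernstein)
      thus ?thesis by blast
    qed
    then obtain Q where good: "\<And>j. good j (Q j)" by metis
    have Q2: "\<bar>Q j m u\<bar> \<le> 2" if "u \<in> {0..1}" for j m u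
      using good[of j] that unfolding good_def by blast
    have Ql: "(\<lambda>m. Q j m u) \<longlonglongrightarrow> (if u < s j then 1 else 0)" if "u \<in> {0..1}" for j u
      using good[of j] that unfolding good_def by blast
    have Qt: "trig_on UNIV (\<lambda>x. complex_of_real (Q j m (v x)))"
      if "trig_on UNIV (\<lambda>x::real^'d. complex_of_real (v x))" for j m v
      using good[of j] that unfolding good_def by blast
    define \<phi> where "\<phi> m x = (\<Prod>j\<in>UNIV. complex_of_real (Q j m (u j x)))" for m x
    have t\<phi>: "trig_on UNIV (\<phi> m)" for m
      unfolding \<phi>_def by (intro trig_on_prod Qt tu)
    have b\<phi>: "norm (\<phi> m x) \<le> 2 ^ CARD('d)" for m x
    proof -
      have "norm (\<phi> m x) = (\<Prod>j\<in>UNIV. \<bar>Q j m (u j x)\<bar>)"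
        by (simp add: \<phi>_def prod_norm[symmetric])
      also have "\<dots> \<le> (\<Prod>j\<in>(UNIV::'d set). 2)" by (intro prod_mono) (auto intro: Q2 u01)
      finally show ?thesis by simp
    qed
    have l\<phi>: "(\<lambda>m. \<phi> m x) \<longlonglongrightarrow> indicator (box a b) x" if "x \<in> box 0 1" for x
    proof -
      have "(\<lambda>m. \<phi> m x) \<longlonglongrightarrow> (\<Prod>j\<in>UNIV. complex_of_real (if u j x < s j then 1 else 0))"
        unfolding \<phi>_def by (intro tendsto_prod tendsto_of_real Ql u01)
      also have "(\<Prod>j\<in>UNIV. complex_of_real (if u j x < s j then 1 else 0)) = indicator (box a b) x"
      proof (cases "\<forall>j. u j x < s j")
        case False
        hence "x \<notin> box a b" using ius[OF that] by simp
        moreover have "(\<Prod>j\<in>UNIV. complex_of_real (if u j x < s j then 1 else 0)) = 0"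
          using False by (intro prod_zero) auto
        ultimately show ?thesis by simp
      qed (use ius[OF that] in \<open>auto simp: indicator_def\<close>)
      finally show ?thesis .
    qed
    have hm: "h \<in> borel_measurable torus" using h by auto
    have bm: "indicator (box a b) \<in> borel_measurable torus"
      by (intro measurable_torus borel_measurable_indicator) auto
    have "(\<lambda>m. LINT x|torus. h x * \<phi> m x) \<longlonglongrightarrow> (LINT x|torus. indicator (box a b) x *\<^sub>R h x)"
    proof (rule integral_dominated_convergence[where w = "\<lambda>x. norm (h x) * 2 ^ CARD('d)"])
      show "(\<lambda>x. indicator (box a b) x *\<^sub>R h x) \<in> borel_measurable torus"
        using hm bm by measurable
      show "(\<lambda>x. h x * \<phi> m x) \<in> borel_measurable torus" for m
        using hm measurable_torus[OF borel_measurable_continuous_onI[OF trig_on_continuous[OF t\<phi>[of m]]]]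
        by measurable
      show "integrable torus (\<lambda>x. norm (h x) * 2 ^ CARD('d))" using h by (intro integrable_mult_left integrable_norm)
      show "AE x in torus. (\<lambda>m. h x * \<phi> m x) \<longlonglongrightarrow> indicator (box a b) x *\<^sub>R h x"
        using AE_torus_box
      proof eventually_elim
        case (elim x)
        have "(\<lambda>m. h x * \<phi> m x) \<longlonglongrightarrow> h x * indicator (box a b) x" by (intro tendsto_intros l\<phi> elim)
        thus ?case by (cases "x \<in> box a b") simp_all
      qed
      show "AE x in torus. norm (h x * \<phi> m x) \<le> norm (h x) * 2 ^ CARD('d)" for m
        by (intro AE_I2) (simp add: norm_mult mult_left_mono b\<phi>)
    qed
    moreover have "(LINT x|torus. h x * \<phi> m x) = 0" for m by (rule orth[OF t\<phi>])
    ultimately show ?thesis by (simp add: LIMSEQ_const_iff)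
  qed
qed

text \<open>Open boxes form an intersection-stable generator of the Borel sets, so the vanishing of
  integrals over boxes spreads to all Borel sets; the complement step uses the constant polynomial
  1. A function all of whose set integrals vanish is zero almost everywhere.\<close>

lemma orthogonal_to_trig_imp_zero:
  fixes h :: "real^'d \<Rightarrow> complex"
  assumes h: "integrable torus h"
    and orth: "\<And>\<phi>. trig_on UNIV \<phi> \<Longrightarrow> (LINT x|torus. h x * \<phi> x) = 0"
  shows "AE x in torus. h x = 0"
proof -
  interpret finite_measure "torus :: (real^'d) measure" by (rule finite_measure_torus)
  have tm: "A \<in> sets torus \<longleftrightarrow> A \<in> sets borel \<and> A \<subseteq> cbox 0 1" for A :: "(real^'d) set"
    by (auto simp: sets_torus sets_restrict_space_iff)
  have int: "integrable torus (\<lambda>x. indicator A x *\<^sub>R h x)" if "A \<in> sets borel" for A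
  proof -
    have "integrable torus (\<lambda>x. indicator (A \<inter> cbox 0 1) x *\<^sub>R h x)"
      using that by (intro integrable_mult_indicator h) (auto simp: tm)
    thus ?thesis by (rule Bochner_Integration.integrable_cong[THEN iffD1, rotated -1]) (auto simp: indicator_def)
  qed
  have key: "(LINT x|torus. indicator A x *\<^sub>R h x) = 0" if A: "A \<in> sets borel" for A
  proof -
    have "Int_stable (range (\<lambda>(a, b). box a b :: (real^'d) set))"
      by (auto simp: Int_stable_def box_Int_box)
    moreover have "range (\<lambda>(a, b). box a b :: (real^'d) set) \<subseteq> Pow UNIV"
      by auto
    moreover have "A \<in> sigma_sets UNIV (range (\<lambda>(a, b). box a b))"
      using A unfolding borel_eq_box by simp
    ultimately show ?thesis
    proof (induction rule: sigma_sets_induct_disjoint)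
      case (basic A)
      then show ?case using integral_box_zero[OF h orth] by auto
    next
      case empty
      then show ?case by simp
    next
      case (compl A)
      hence [measurable]: "A \<in> sets borel" by (simp add: borel_eq_box)
      have "(LINT x|torus. indicator (UNIV - A) x *\<^sub>R h x) = (LINT x|torus. h x - indicator A x *\<^sub>R h x)"
        by (intro Bochner_Integration.integral_cong refl) (auto simp: indicator_def)
      also have "\<dots> = (LINT x|torus. h x) - (LINT x|torus. indicator A x *\<^sub>R h x)"
        by (intro Bochner_Integration.integral_diff h int) auto
      also have "(LINT x|torus. h x) = 0"
        using orth[OF trig_on_const[of UNIV 1]] by simp
      finally show ?case using compl by simp
    next
      case (union F)
      hence F: "F i \<in> sets borel" for i by (simp add: borel_eq_box subset_eq)
      have piece: "(LINT x:(F i \<inter> cbox 0 1)|torus. h x) = (LINT x|torus. indicator (F i) x *\<^sub>R h x)" for i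
        unfolding set_lebesgue_integral_def
        by (intro Bochner_Integration.integral_cong refl) (auto simp: indicator_def)
      have "(LINT x|torus. indicator (\<Union>i. F i) x *\<^sub>R h x) =
            (LINT x:(\<Union>i. F i \<inter> cbox 0 1)|torus. h x)"
        unfolding set_lebesgue_integral_def
        by (intro Bochner_Integration.integral_cong refl) (auto simp: indicator_def)
      also have "\<dots> = (\<Sum>i. (LINT x:(F i \<inter> cbox 0 1)|torus. h x))"
      proof (rule lebesgue_integral_countable_add)
        show "F i \<inter> cbox 0 1 \<in> sets torus" for i using F by (auto simp: tm)
        show "(F i \<inter> cbox 0 1) \<inter> (F j \<inter> cbox 0 1) = {}" if "i \<noteq> j" for i j
          using union(1) that by (auto simp: disjoint_family_on_def)
        show "set_integrable torus (\<Union>i. F i \<inter> cbox 0 1) h"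
          unfolding set_integrable_def by (intro integrable_mult_indicator h) (use F in \<open>auto simp: tm\<close>)
      qed
      also have "\<dots> = (\<Sum>i. (LINT x|torus. indicator (F i) x *\<^sub>R h x))"
        by (simp only: piece)
      also have "\<dots> = 0" by (simp only: union.IH suminf_zero)
      finally show ?case .
    qed
  qed
  have "set_lebesgue_integral torus A h = 0" if "A \<in> sets torus" for A
    using key[of A] that by (simp add: tm set_lebesgue_integral_def)
  thus ?thesis by (rule density_zero[OF h])
qed

lemma Lp_norm_1: "Lp_norm 1 f = (LINT x|torus. norm (f x))"
proof -
  have "0 \<le> (LINT x|torus. norm (f x))" by simp
  thus ?thesis by (simp add: Lp_norm_def)
qed

lemma Lp_1_integrable:
  assumes "f \<in> Lp 1"
  shows "integrable torus f"
proof -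
  have "integrable torus (\<lambda>x. norm (f x))" "f \<in> borel_measurable borel"
    using assms by (simp_all add: Lp_def)
  thus ?thesis using integrable_norm_cancel measurable_torus by blast
qed

text \<open>Trigonometric polynomials are already enough test functions to determine a weak derivative.\<close>

lemma W11_norm_trig:
  assumes "trig_on S f"
  shows "W11_norm f = (LINT x|torus. norm (f x)) + (\<Sum>j\<in>UNIV. LINT x|torus. norm (partial j f x))"
proof -
  have "Lp_norm 1 (weak_partial j f) = (LINT x|torus. norm (partial j f x))" for j
  proof -
    define g where "g = weak_partial j f"
    note tp = trig_on_partial[OF assms, of j]
    \<comment> \<open>The classical derivative is a witness, so the choice in
      \<open>weak_partial\<close> does return a weak derivative.\<close>
    have "\<exists>g. g \<in> Lp 1 \<and> is_weak_partial j f g"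
      using trig_on_Lp_1[OF tp] trig_on_weak_partial[OF assms] by blast
    hence "g \<in> Lp 1 \<and> is_weak_partial j f g"
      unfolding g_def weak_partial_def by (rule someI_ex)
    hence g: "g \<in> Lp 1" "is_weak_partial j f g" by auto
    have gi: "integrable torus g" "integrable torus (partial j f)"
      using Lp_1_integrable g(1) trig_on_Lp_1[OF tp] by auto
    have "AE x in torus. g x - partial j f x = 0"
    proof (rule orthogonal_to_trig_imp_zero)
      show "integrable torus (\<lambda>x. g x - partial j f x)" using gi by auto
      fix \<phi> :: "real^'a \<Rightarrow> complex" assume t: "trig_on UNIV \<phi>"
      have "(LINT x|torus. (g x - partial j f x) * \<phi> x) =
            (LINT x|torus. g x * \<phi> x) - (LINT x|torus. partial j f x * \<phi> x)"
        unfolding left_diff_distrib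
        by (intro Bochner_Integration.integral_diff integrable_torus_mult gi trig_on_continuous[OF t])
      also have "\<dots> = 0"
        using g(2) trig_on_weak_partial[OF assms, of j] trig_on_test_function[OF t]
        unfolding is_weak_partial_def by simp
      finally show "(LINT x|torus. (g x - partial j f x) * \<phi> x) = 0" .
    qed
    hence "(LINT x|torus. norm (g x)) = (LINT x|torus. norm (partial j f x))"
      using gi by (intro integral_cong_AE) (auto elim!: eventually_mono)
    thus ?thesis by (simp add: Lp_norm_1 g_def)
  qed
  thus ?thesis by (simp add: W11_norm_def Lp_norm_1)
qed

subsection \<open>A weak-type Hausdorff--Young inequality\<close>

lemma fourier_coeff_sum:
  assumes "\<And>i. i \<in> I \<Longrightarrow> continuous_on UNIV (f i)"
  shows "fourier_coeff (\<lambda>x. \<Sum>i\<in>I. f i x) n = (\<Sum>i\<in>I. fourier_coeff (f i) n)"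
  using assms
proof (induction I rule: infinite_finite_induct)
  case (insert i I)
  thus ?case by (simp add: fourier_coeff_add continuous_on_sum)
qed (simp_all add: fourier_coeff_def)

lemma parseval_sum:
  fixes c :: "'i \<Rightarrow> complex" and \<sigma> :: "'i \<Rightarrow> int^'d"
  assumes "finite A" "inj_on \<sigma> A"
  shows "(LINT x|torus. (norm (\<Sum>n\<in>A. c n * tchar (\<sigma> n) x))\<^sup>2) = (\<Sum>n\<in>A. (norm (c n))\<^sup>2)"
proof -
  have "complex_of_real (LINT x|torus. (norm (\<Sum>n\<in>A. c n * tchar (\<sigma> n) x))\<^sup>2) =
        (LINT x|torus. complex_of_real ((norm (\<Sum>n\<in>A. c n * tchar (\<sigma> n) x))\<^sup>2))"
    by (rule integral_complex_of_real[symmetric])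
  also have "\<dots> = (LINT x|torus. (\<Sum>m\<in>A. \<Sum>n\<in>A. c m * cnj (c n) * tchar (\<sigma> m - \<sigma> n) x))"
  proof (rule Bochner_Integration.integral_cong[OF refl])
    fix x
    have "complex_of_real ((norm (\<Sum>n\<in>A. c n * tchar (\<sigma> n) x))\<^sup>2) =
          (\<Sum>m\<in>A. c m * tchar (\<sigma> m) x) * (\<Sum>n\<in>A. cnj (c n) * tchar (- \<sigma> n) x)"
      by (subst complex_norm_square) (simp add: tchar_minus)
    also have "\<dots> = (\<Sum>m\<in>A. \<Sum>n\<in>A. (c m * tchar (\<sigma> m) x) * (cnj (c n) * tchar (- \<sigma> n) x))"
      by (rule sum_product)
    also have "\<dots> = (\<Sum>m\<in>A. \<Sum>n\<in>A. c m * cnj (c n) * tchar (\<sigma> m - \<sigma> n) x)"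
      by (intro sum.cong refl) (simp add: tchar_add diff_conv_add_uminus del: add_uminus_conv_diff)
    finally show "complex_of_real ((norm (\<Sum>n\<in>A. c n * tchar (\<sigma> n) x))\<^sup>2) =
       (\<Sum>m\<in>A. \<Sum>n\<in>A. c m * cnj (c n) * tchar (\<sigma> m - \<sigma> n) x)" .
  qed
  also have "\<dots> = (\<Sum>m\<in>A. \<Sum>n\<in>A. c m * cnj (c n) * (LINT x|torus. tchar (\<sigma> m - \<sigma> n) x))"
    by (subst Bochner_Integration.integral_sum,
        (intro integrable_torus_continuous continuous_intros continuous_tchar)[1],
        subst Bochner_Integration.integral_sum,
        (intro integrable_torus_continuous continuous_intros continuous_tchar)[1]) simp
  also have "\<dots> = (\<Sum>m\<in>A. \<Sum>n\<in>A. if m = n then c m * cnj (c n) else 0)"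
    by (intro sum.cong refl) (use assms in \<open>auto simp: integral_tchar inj_on_def\<close>)
  also have "\<dots> = (\<Sum>m\<in>A. c m * cnj (c m))"
    using assms(1) by (simp add: sum.delta)
  also have "\<dots> = complex_of_real (\<Sum>n\<in>A. (norm (c n))\<^sup>2)"
    unfolding of_real_sum complex_norm_square ..
  finally show ?thesis unfolding of_real_eq_iff .
qed

lemma Lp_integrable:
  assumes "1 < p" "g \<in> Lp p"
  shows "integrable torus g"
proof (rule Bochner_Integration.integrable_bound)
  interpret finite_measure "torus :: (real^'a) measure" by (rule finite_measure_torus)
  show "integrable torus (\<lambda>x. 1 + norm (g x) powr p)"
    using assms(2) by (auto simp: Lp_def)
  show "g \<in> borel_measurable torus" using assms(2) by (auto simp: Lp_def intro: measurable_torus)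
  show "AE x in torus. norm (g x) \<le> norm (1 + norm (g x) powr p)"
  proof (rule AE_I2)
    fix x
    have "norm (g x) \<le> 1 + norm (g x) powr p"
    proof (cases "norm (g x) \<le> 1")
      case False
      hence "norm (g x) powr 1 \<le> norm (g x) powr p" using assms(1) by (intro powr_mono) auto
      thus ?thesis by simp
    qed (simp add: add_increasing2)
    thus "norm (g x) \<le> norm (1 + norm (g x) powr p)" by simp
  qed
qed

text \<open>
  Weak-type Hausdorff--Young: test \<open>g\<close> against a unimodular combination \<open>h\<close> of the characters in
  \<open>A\<close>, for which \<open>\<parallel>h\<parallel>\<^sub>\<infinity> \<le> card A\<close> and \<open>\<parallel>h\<parallel>\<^sub>2\<^sup>2 = card A\<close>.
\<close>

lemma weak_hausdorff_young:
  fixes g :: "real^'d \<Rightarrow> complex"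
  assumes p: "1 < p" "p \<le> 2" and g: "g \<in> Lp p" and A: "finite A" and s: "s > 0"
    and big: "\<And>n. n \<in> A \<Longrightarrow> s \<le> norm (fourier_coeff g n)"
  shows "real (card A) \<le> (Lp_norm p g / s) powr (p / (p - 1))"
proof (cases "A = {}")
  case False
  define N where "N = real (card A)"
  have N: "N \<ge> 1" using False A by (simp add: N_def card_gt_0_iff Suc_leI)
  define q where "q = p / (p - 1)"
  have q: "q \<ge> 2" "1 / p + 1 / q = 1" using p by (auto simp: q_def field_simps)
  define G where "G = (LINT x|torus. norm (g x) powr p)"
  have G0: "G \<ge> 0" by (simp add: G_def)
  have gi: "integrable torus g" "integrable torus (\<lambda>x. norm (g x) powr p)"
    using Lp_integrable[OF p(1) g] g by (auto simp: Lp_def)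
  \<comment> \<open>These unimodular (or zero) factors turn the pairing of \<open>g\<close> with
    \<open>h\<close> into the sum of the absolute values of the coefficients.\<close>
  define c where "c n = cnj (sgn (fourier_coeff g n))" for n
  have nc: "norm (c n) \<le> 1" for n by (simp add: c_def norm_sgn)
  have cf: "c n * fourier_coeff g n = of_real (norm (fourier_coeff g n))" for n
  proof (cases "fourier_coeff g n = 0")
    case False
    have "cnj z * z = (of_real (norm z))\<^sup>2" for z
      using complex_norm_square[of z] by (simp add: mult.commute)
    thus ?thesis using False
      by (simp add: c_def sgn_eq field_simps power2_eq_square)
  qed (simp add: c_def)
  define h where "h x = (\<Sum>n\<in>A. c n * tchar (- n) x)" for x
  have hc: "continuous_on UNIV h"
    unfolding h_def by (intro continuous_intros continuous_tchar)
  have hN: "norm (h x) \<le> N" for x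
  proof -
    have "norm (h x) \<le> (\<Sum>n\<in>A. 1)"
      unfolding h_def by (rule sum_norm_le) (simp add: norm_mult nc)
    thus ?thesis by (simp add: N_def)
  qed
  have h2: "(LINT x|torus. (norm (h x))\<^sup>2) \<le> N"
  proof -
    have "(LINT x|torus. (norm (h x))\<^sup>2) = (\<Sum>n\<in>A. (norm (c n))\<^sup>2)"
      unfolding h_def by (rule parseval_sum[OF A]) (auto simp: inj_on_def)
    also have "\<dots> \<le> (\<Sum>n\<in>A. 1)" by (intro sum_mono) (simp add: nc power_le_one)
    finally show ?thesis by (simp add: N_def)
  qed
  have "N * s = (\<Sum>n\<in>A. s)" by (simp add: N_def)
  also have "\<dots> \<le> (\<Sum>n\<in>A. norm (fourier_coeff g n))" by (intro sum_mono big)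
  also have "\<dots> = norm (\<Sum>n\<in>A. c n * fourier_coeff g n)"
    unfolding cf of_real_sum[symmetric] norm_of_real by (simp add: sum_nonneg)
  also have "(\<Sum>n\<in>A. c n * fourier_coeff g n) = (LINT x|torus. g x * h x)"
  proof -
    have "(LINT x|torus. g x * h x) = (LINT x|torus. (\<Sum>n\<in>A. c n * (g x * tchar (- n) x)))"
      by (simp add: h_def sum_distrib_left algebra_simps)
    also have "\<dots> = (\<Sum>n\<in>A. (LINT x|torus. c n * (g x * tchar (- n) x)))"
      by (intro Bochner_Integration.integral_sum integrable_mult_right integrable_torus_mult gi continuous_tchar)
    finally show ?thesis by (simp add: fourier_coeff_eq_tchar)
  qed
  also have "norm (LINT x|torus. g x * h x) \<le> (LINT x|torus. norm (g x * h x))"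
    by (rule integral_norm_bound)
  finally have Ns: "N * s \<le> (LINT x|torus. norm (g x * h x))" .
  \<comment> \<open>The weight in Young's inequality is tuned so that, after bounding
    \<open>norm (h x) powr q\<close> by \<open>N powr (q - 2)\<close> times the square, the second
    term is exactly \<open>s / q\<close> times the square of \<open>norm (h x)\<close>. Its integral
    is at most the fraction \<open>1 / q\<close> of the left side \<open>N * s\<close> and can be
    absorbed.\<close>
  define \<kappa> where "\<kappa> = (s * N powr (2 - q)) powr (- 1 / q)"
  have \<kappa>: "\<kappa> > 0" using s N by (simp add: \<kappa>_def)
  have \<kappa>q: "\<kappa> powr (- q) = s * N powr (2 - q)" using q s N by (simp add: \<kappa>_def powr_powr)
  have pq: "p / q = p - 1" "(2 - q) * (p - 1) = p - 2" using p by (auto simp: q_def field_simps)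
  have \<kappa>p: "\<kappa> powr p = s powr (1 - p) * N powr (2 - p)"
  proof -
    have "\<kappa> powr p = (s * N powr (2 - q)) powr (- (p / q))"
      by (simp add: \<kappa>_def powr_powr)
    also have "\<dots> = s powr (1 - p) * N powr ((2 - q) * (- (p - 1)))"
      using s N unfolding pq(1) by (simp add: powr_mult powr_powr)
    also have "(2 - q) * (- (p - 1)) = 2 - p" using pq(2) by (simp add: algebra_simps)
    finally show ?thesis .
  qed
  have young: "norm (g x * h x) \<le> \<kappa> powr p / p * norm (g x) powr p + s / q * (norm (h x))\<^sup>2" for x
  proof -
    have "norm (g x * h x) = (\<kappa> * norm (g x)) * (norm (h x) / \<kappa>)"
      using \<kappa> by (simp add: norm_mult)
    also have "\<dots> \<le> (\<kappa> * norm (g x)) powr p / p + (norm (h x) / \<kappa>) powr q / q"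
      using \<kappa> q p by (intro Youngs_inequality) auto
    also have "(\<kappa> * norm (g x)) powr p / p = \<kappa> powr p / p * norm (g x) powr p"
      using \<kappa> by (simp add: powr_mult)
    also have "(norm (h x) / \<kappa>) powr q = norm (h x) powr q * (s * N powr (2 - q))"
      unfolding \<kappa>q[symmetric] powr_minus using \<kappa> by (simp add: powr_divide divide_inverse[symmetric])
    \<comment> \<open>This is where \<open>p \<le> 2\<close> enters: it gives
      \<open>q \<ge> 2\<close>, so the surplus power of \<open>norm (h x)\<close> can be bounded by
      the supremum \<open>N\<close>.\<close>
    also have "norm (h x) powr q \<le> N powr (q - 2) * (norm (h x))\<^sup>2"
    proof (cases "h x = 0")
      case False
      hence "norm (h x) powr q = norm (h x) powr (q - 2) * norm (h x) powr 2"
        unfolding powr_add[symmetric] by simp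
      also have "\<dots> \<le> N powr (q - 2) * norm (h x) powr 2"
        using q hN by (intro mult_right_mono powr_mono2) auto
      finally show ?thesis using False by simp
    qed simp
    also have "N powr (q - 2) * (norm (h x))\<^sup>2 * (s * N powr (2 - q)) = s * (norm (h x))\<^sup>2"
    proof -
      have "N powr (q - 2) * N powr (2 - q) = 1" using N by (simp flip: powr_add)
      thus ?thesis by (simp add: algebra_simps)
    qed
    finally show ?thesis using s N q by (simp add: mult_right_mono divide_right_mono)
  qed
  have h2i: "integrable torus (\<lambda>x. (norm (h x))\<^sup>2)"
    by (intro integrable_torus_continuous continuous_intros hc)
  have ri: "integrable torus (\<lambda>x. \<kappa> powr p / p * norm (g x) powr p + s / q * (norm (h x))\<^sup>2)"
    by (intro Bochner_Integration.integrable_add integrable_mult_right gi h2i)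
  have "N * s \<le> (LINT x|torus. norm (g x * h x))" by (rule Ns)
  also have "\<dots> \<le> (LINT x|torus. \<kappa> powr p / p * norm (g x) powr p + s / q * (norm (h x))\<^sup>2)"
    by (rule integral_mono[OF integrable_norm[OF integrable_torus_mult[OF gi(1) hc]] ri young])
  also have "\<dots> = \<kappa> powr p / p * G + s / q * (LINT x|torus. (norm (h x))\<^sup>2)"
    using gi h2i by (simp add: G_def)
  also have "\<dots> \<le> \<kappa> powr p / p * G + s / q * N"
    using h2 s q by (intro add_left_mono mult_left_mono) auto
  finally have "N * s * (1 - 1 / q) \<le> \<kappa> powr p / p * G" by (simp add: field_simps)
  also have "1 - 1 / q = 1 / p" using q by simp
  finally have "N * s \<le> \<kappa> powr p * G" using p by (simp add: field_simps)
  hence "N * s \<le> (s powr (1 - p) * N powr (2 - p)) * G" unfolding \<kappa>p .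
  \<comment> \<open>The factor cancels the powers of \<open>s\<close> and \<open>N\<close> on the
    right and leaves \<open>N powr (p - 1) * s powr p \<le> G\<close>.\<close>
  hence "(N * s) * (s powr (p - 1) * N powr (p - 2)) \<le>
     ((s powr (1 - p) * N powr (2 - p)) * G) * (s powr (p - 1) * N powr (p - 2))"
    using s N by (intro mult_right_mono) auto
  also have "\<dots> = (s powr (1 - p) * s powr (p - 1)) * (N powr (2 - p) * N powr (p - 2)) * G"
    by (simp add: algebra_simps)
  also have "\<dots> = G" using s N by (simp flip: powr_add)
  also have "(N * s) * (s powr (p - 1) * N powr (p - 2)) = (N powr 1 * N powr (p - 2)) * (s powr 1 * s powr (p - 1))"
    using s N by simp
  also have "\<dots> = N powr (p - 1) * s powr p"
    unfolding powr_add[symmetric] by simp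
  finally have "N powr (p - 1) \<le> G / s powr p" using s by (simp add: field_simps)
  hence "(N powr (p - 1)) powr (1 / (p - 1)) \<le> (G / s powr p) powr (1 / (p - 1))"
    using p N by (intro powr_mono2) auto
  also have "(N powr (p - 1)) powr (1 / (p - 1)) = N" using p N by (simp add: powr_powr)
  also have "G / s powr p = (Lp_norm p g / s) powr p"
    using G0 p s by (simp add: Lp_norm_def G_def[symmetric] powr_divide powr_powr)
  also have "\<dots> powr (1 / (p - 1)) = (Lp_norm p g / s) powr (p / (p - 1))"
    by (simp add: powr_powr)
  finally show ?thesis by (simp add: N_def)
qed simp

subsection \<open>Frequencies in a cube\<close>

definition cube :: "nat \<Rightarrow> (int^'d) set" where
  "cube R = {m. \<forall>i. \<bar>m $ i\<bar> \<le> int R}"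

lemma finite_cube: "finite (cube R :: (int^'d) set)"
  and card_cube: "card (cube R :: (int^'d) set) = (2 * R + 1) ^ CARD('d)"
proof -
  let ?P = "PiE (UNIV :: 'd set) (\<lambda>_. {- int R..int R})"
  have b: "bij_betw vec_lambda ?P (cube R :: (int^'d) set)"
    by (rule bij_betwI[where g = vec_nth]) (auto simp: cube_def PiE_def Pi_def abs_le_iff minus_le_iff)
  have f: "finite ?P" by (intro finite_PiE) auto
  show "finite (cube R :: (int^'d) set)" using bij_betw_finite[OF b] f by simp
  have "card (cube R :: (int^'d) set) = card ?P" using bij_betw_same_card[OF b] by simp
  also have "\<dots> = (2 * R + 1) ^ CARD('d)" by (subst card_PiE) (auto simp: nat_add_distrib nat_mult_distrib)
  finally show "card (cube R :: (int^'d) set) = (2 * R + 1) ^ CARD('d)" .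
qed

definition dirichlet :: "nat \<Rightarrow> real^'d \<Rightarrow> complex" where
  "dirichlet R x = (\<Sum>m\<in>cube R. tchar m x)"

lemma trig_on_dirichlet: "trig_on (cube R) (dirichlet R)"
  unfolding dirichlet_def by (intro trig_on_sum trig_on_tchar)

lemma partial_sum_tchar:
  assumes "finite A"
  shows "partial j (\<lambda>x. \<Sum>m\<in>A. c m * tchar m x) x = (\<Sum>m\<in>A. c m * (2 * pi * \<i> * of_int (m $ j)) * tchar m x)"
  using assms
proof (induction A rule: finite_induct)
  case empty
  show ?case by (simp add: partialI[OF has_derivative_const])
next
  case (insert m A)
  have "(\<lambda>x. \<Sum>m\<in>A. c m * tchar m x) differentiable (at x)"
    by (intro trig_on_differentiable[of UNIV] trig_on_sum trig_on_cmult trig_on_tchar) auto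
  thus ?case using insert
    by (simp add: partial_linear_comb tchar_differentiable partial_tchar)
qed

lemma dirichlet_L2: "(LINT x|torus. (norm (dirichlet R (x :: real^'d)))\<^sup>2) = card (cube R :: (int^'d) set)"
  using parseval_sum[OF finite_cube, of "\<lambda>m. m" R "\<lambda>_. 1"] by (simp add: dirichlet_def)

lemma partial_dirichlet_L2:
  "(LINT x|torus. (norm (partial j (dirichlet R) (x :: real^'d)))\<^sup>2) \<le> (2 * pi * R)\<^sup>2 * card (cube R :: (int^'d) set)"
proof -
  have "partial j (dirichlet R) x = (\<Sum>m\<in>cube R. (2 * pi * \<i> * of_int (m $ j)) * tchar m x)" for x :: "real^'d"
    using partial_sum_tchar[OF finite_cube, of j "\<lambda>_. 1" R x] by (simp add: dirichlet_def[abs_def])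
  hence "(LINT x|torus. (norm (partial j (dirichlet R) (x::real^'d)))\<^sup>2) =
      (\<Sum>m\<in>(cube R :: (int^'d) set). (norm (2 * pi * \<i> * complex_of_int (m $ j)))\<^sup>2)"
    by (simp only:) (rule parseval_sum[OF finite_cube, of "\<lambda>m. m"], simp)
  also have "\<dots> \<le> (\<Sum>m\<in>(cube R :: (int^'d) set). (2 * pi * R)\<^sup>2)"
  proof (intro sum_mono power_mono)
    fix m :: "int^'d" assume "m \<in> cube R"
    hence "\<bar>real_of_int (m $ j)\<bar> \<le> real R" unfolding cube_def by (auto dest!: spec[of _ j])
    thus "norm (2 * pi * \<i> * complex_of_int (m $ j)) \<le> 2 * pi * R"
      by (simp add: norm_mult)
  qed simp
  finally show ?thesis by (simp add: mult.commute)
qed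

text \<open>The kernel is the product of the Dirichlet kernel of the doubled cube with the conjugate
  one of the cube, divided by \<open>B\<close>. Its coefficient at \<open>n\<close> averages the
  coefficients of the larger kernel over \<open>n + m\<close> with \<open>m\<close> in the cube,
  hence is 1. A product of two functions has an L1 norm controlled by L2 norms, which Parseval
  computes; doubling the radius costs at most \<open>2 ^ d\<close>.\<close>

lemma cube_test_function:
  fixes R :: nat
  assumes R: "R \<ge> 1"
  defines "d \<equiv> CARD('d)"
  shows "\<exists>f :: real^'d \<Rightarrow> complex. trig_on UNIV f \<and> (\<forall>n\<in>cube R. fourier_coeff f n = 1) \<and>
     W11_norm f \<le> 2 ^ d * (1 + d * (1 + 10 * pi\<^sup>2)) * R"
proof -
  define B where "B = real (card (cube R :: (int^'d) set))"
  define B' where "B' = real (card (cube (2 * R) :: (int^'d) set))"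
  have B: "B \<ge> 1" "B \<le> 2 ^ d * B" by (auto simp: B_def card_cube simp flip: of_nat_add of_nat_mult of_nat_Suc)
  have B'B: "B' \<le> 2 ^ d * B"
  proof -
    have "B' \<le> real ((2 * (2 * R + 1)) ^ d)"
      unfolding B'_def card_cube d_def of_nat_le_iff by (intro power_mono) auto
    also have "\<dots> = 2 ^ d * B"
      by (simp only: power_mult_distrib B_def card_cube d_def of_nat_mult of_nat_power of_nat_numeral)
    finally show ?thesis .
  qed
  define u :: "real^'d \<Rightarrow> complex" where "u = dirichlet (2 * R)"
  define v :: "real^'d \<Rightarrow> complex" where "v x = cnj (dirichlet R x)" for x
  define f where "f x = 1 / B * (u x * v x)" for x
  have tu: "trig_on UNIV u" unfolding u_def by (rule trig_on_mono[OF trig_on_dirichlet]) auto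
  have tv: "trig_on UNIV v" unfolding v_def by (rule trig_on_mono[OF trig_on_cnj[OF trig_on_dirichlet]]) auto
  have tf: "trig_on UNIV f" unfolding f_def by (intro trig_on_cmult trig_on_UNIV_mult tu tv)
  note cont = trig_on_continuous[OF tu] trig_on_continuous[OF tv]
    trig_on_continuous[OF trig_on_partial[OF tu]] trig_on_continuous[OF trig_on_partial[OF tv]]
    trig_on_continuous[OF tf] trig_on_continuous[OF trig_on_partial[OF tf]]
  have fc: "fourier_coeff f n = 1" if n: "n \<in> cube R" for n
  proof -
    have "fourier_coeff f n = 1 / B * fourier_coeff (\<lambda>x. \<Sum>m\<in>cube R. tchar (- m) x * u x) n"
      unfolding f_def fourier_coeff_cmult
      by (simp add: v_def dirichlet_def tchar_minus sum_distrib_left mult.commute)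
    also have "fourier_coeff (\<lambda>x. \<Sum>m\<in>cube R. tchar (- m) x * u x) n = (\<Sum>m\<in>cube R. fourier_coeff u (n + m))"
      by (subst fourier_coeff_sum) (auto intro!: continuous_intros continuous_tchar cont simp: fourier_coeff_tchar_mult)
    also have "\<dots> = (\<Sum>m\<in>(cube R :: (int^'d) set). 1)"
    proof (intro sum.cong refl)
      fix m :: "int^'d" assume m: "m \<in> cube R"
      have "n + m \<in> cube (2 * R)"
        unfolding cube_def
      proof (intro CollectI allI)
        fix i
        have "\<bar>n $ i\<bar> \<le> int R" "\<bar>m $ i\<bar> \<le> int R" using n m by (auto simp: cube_def)
        thus "\<bar>(n + m) $ i\<bar> \<le> int (2 * R)" by simp
      qed
      thus "fourier_coeff u (n + m) = 1"
        unfolding u_def dirichlet_def[abs_def]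
        by (subst fourier_coeff_sum) (auto simp: continuous_tchar fourier_coeff_tchar finite_cube)
    qed
    finally show ?thesis using B by (simp add: B_def)
  qed
  have i2: "integrable torus (\<lambda>x. (norm (w x))\<^sup>2)" if "continuous_on UNIV w" for w :: "real^'d \<Rightarrow> complex"
    by (intro integrable_torus_continuous continuous_intros that)
  \<comment> \<open>Cauchy-Schwarz in additive form with a free weight: \<open>k = 1\<close> for the
    kernel itself, and \<open>k = R\<close> when one factor is differentiated, since that raises L2
    norms by a factor of order \<open>R\<close>.\<close>
  have amgm: "(LINT x|torus. norm (a x * b x)) \<le> ((LINT x|torus. (norm (a x))\<^sup>2) / k + k * (LINT x|torus. (norm (b x))\<^sup>2)) / 2"
    if "continuous_on UNIV a" "continuous_on UNIV b" "k > 0" for a b :: "real^'d \<Rightarrow> complex" and k :: real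
  proof -
    have "(LINT x|torus. norm (a x * b x)) \<le> (LINT x|torus. ((norm (a x))\<^sup>2 / k + k * (norm (b x))\<^sup>2) / 2)"
    proof (rule integral_torus_mono)
      fix x
      have "0 \<le> (norm (a x) - k * norm (b x))\<^sup>2 / k" using that by simp
      thus "norm (a x * b x) \<le> ((norm (a x))\<^sup>2 / k + k * (norm (b x))\<^sup>2) / 2"
        using that(3) by (simp add: norm_mult field_simps power2_eq_square)
    qed (use that in \<open>auto intro!: continuous_intros\<close>)
    also have "\<dots> = ((LINT x|torus. (norm (a x))\<^sup>2) / k + k * (LINT x|torus. (norm (b x))\<^sup>2)) / 2"
      using i2[OF that(1)] i2[OF that(2)] by simp
    finally show ?thesis .
  qed
  have nv: "(LINT x|torus. (norm (v x))\<^sup>2) = B"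
    using dirichlet_L2[where 'd='d, of R] by (simp add: v_def B_def)
  have nu: "(LINT x|torus. (norm (u x))\<^sup>2) = B'"
    using dirichlet_L2[where 'd='d, of "2 * R"] by (simp add: u_def B'_def)
  have npu: "(LINT x|torus. (norm (partial j u x))\<^sup>2) \<le> (2 * pi * (2 * R))\<^sup>2 * B'" for j
    using partial_dirichlet_L2[of j "2 * R"] by (simp add: u_def B'_def)
  have npv: "(LINT x|torus. (norm (partial j v x))\<^sup>2) \<le> (2 * pi * R)\<^sup>2 * B" for j
  proof -
    have "partial j v x = cnj (partial j (dirichlet R) x)" for x
    proof -
      have "(dirichlet R has_derivative frechet_derivative (dirichlet R) (at x)) (at x)"
        using trig_on_differentiable[OF trig_on_dirichlet] frechet_derivative_works by blast
      hence "(v has_derivative (\<lambda>h. cnj (frechet_derivative (dirichlet R) (at x) h))) (at x)"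
        unfolding v_def by (rule has_derivative_cnj)
      thus ?thesis by (subst partialI) (auto simp: partial_def)
    qed
    thus ?thesis using partial_dirichlet_L2[of j R] by (simp add: B_def)
  qed
  have "(LINT x|torus. norm (f x)) = 1 / B * (LINT x|torus. norm (u x * v x))"
    using B by (simp add: f_def norm_mult norm_divide)
  also have "\<dots> \<le> 1 / B * ((B' / 1 + 1 * B) / 2)"
    using amgm[OF cont(1,2), of 1] nu nv by (intro mult_left_mono) auto
  also have "\<dots> \<le> 1 / B * ((2 ^ d * B + 2 ^ d * B) / 2)"
  proof -
    have "B' / 1 + 1 * B \<le> 2 ^ d * B + 2 ^ d * B" using B'B B(2) by linarith
    thus ?thesis using B(1) by (intro mult_left_mono divide_right_mono) simp_all
  qed
  also have "\<dots> = 2 ^ d" using B(1) by simp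
  finally have n0: "(LINT x|torus. norm (f x)) \<le> 2 ^ d" .
  have n1: "(LINT x|torus. norm (partial j f x)) \<le> 2 ^ d * (1 + 10 * pi\<^sup>2) * R" for j
  proof -
    have pf: "partial j f x = 1 / B * (u x * partial j v x + partial j u x * v x)" for x
    proof -
      have dd: "(\<lambda>x. u x * v x) differentiable (at x)" "(\<lambda>x. 0 :: complex) differentiable (at x)"
        by (auto intro!: derivative_intros trig_on_differentiable[OF tu] trig_on_differentiable[OF tv])
      have "partial j f x = 1 / B * partial j (\<lambda>x. u x * v x) x"
        using partial_linear_comb[OF dd, of j "1 / B"]
        by (simp add: f_def[abs_def] partialI[OF has_derivative_const])
      thus ?thesis
        by (simp add: partial_mult trig_on_differentiable[OF tu] trig_on_differentiable[OF tv])
    qed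
    have "(LINT x|torus. norm (partial j f x)) \<le>
       (LINT x|torus. 1 / B * (norm (partial j v x * u x) + norm (partial j u x * v x)))"
    proof (rule integral_torus_mono)
      fix x
      have "norm (partial j f x) = 1 / B * norm (u x * partial j v x + partial j u x * v x)"
        using B by (simp add: pf norm_mult norm_divide)
      also have "\<dots> \<le> 1 / B * (norm (partial j v x * u x) + norm (partial j u x * v x))"
        using B(1) by (intro mult_left_mono norm_triangle_le) (auto simp: mult.commute)
      finally show "norm (partial j f x) \<le> 1 / B * (norm (partial j v x * u x) + norm (partial j u x * v x))" .
    qed (use B(1) in \<open>auto intro!: continuous_intros cont\<close>)
    also have "\<dots> = 1 / B * ((LINT x|torus. norm (partial j v x * u x)) + (LINT x|torus. norm (partial j u x * v x)))"
      by (subst integral_mult_right_zero, subst Bochner_Integration.integral_add)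
         (auto intro!: integrable_torus_continuous continuous_intros cont)
    also have "\<dots> \<le> 1 / B * ((((2 * pi * R)\<^sup>2 * B) / R + R * B') / 2 + (((2 * pi * (2 * R))\<^sup>2 * B') / R + R * B) / 2)"
      using amgm[OF cont(4,1), of R j] amgm[OF cont(3,2), of R j] nu nv R
        divide_right_mono[OF npu[of j], of "real R"] divide_right_mono[OF npv[of j], of "real R"] B(1)
      by (intro mult_left_mono add_mono) auto
    \<comment> \<open>The two brackets add up to the \<open>1 + 10 * pi\<^sup>2\<close> of the
      statement.\<close>
    also have "\<dots> = 1 / B * (R * ((2 * pi\<^sup>2 + 1 / 2) * B + (8 * pi\<^sup>2 + 1 / 2) * B'))"
      using R by (simp add: power2_eq_square field_simps)
    also have "\<dots> \<le> 1 / B * (R * ((2 * pi\<^sup>2 + 1 / 2) * (2 ^ d * B) + (8 * pi\<^sup>2 + 1 / 2) * (2 ^ d * B)))"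
      using B'B B by (intro mult_left_mono add_mono) auto
    also have "\<dots> = 2 ^ d * (1 + 10 * pi\<^sup>2) * R"
      using B(1) by (simp add: field_simps)
    finally show ?thesis .
  qed
  have "W11_norm f \<le> 2 ^ d + (\<Sum>j\<in>(UNIV :: 'd set). 2 ^ d * (1 + 10 * pi\<^sup>2) * R)"
    unfolding W11_norm_trig[OF tf] by (intro add_mono sum_mono n0 n1)
  also have "\<dots> \<le> 2 ^ d * R + d * (2 ^ d * (1 + 10 * pi\<^sup>2) * R)"
    using R by (auto simp: d_def)
  also have "\<dots> = 2 ^ d * (1 + d * (1 + 10 * pi\<^sup>2)) * R" by (simp add: algebra_simps)
  finally show ?thesis using tf fc by blast
qed

subsection \<open>Riesz products with nearly parallel frequencies\<close>

definition tcos :: "int^'d \<Rightarrow> real^'d \<Rightarrow> complex" where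
  "tcos n x = (tchar n x + tchar (- n) x) / 2"

definition tsin :: "int^'d \<Rightarrow> real^'d \<Rightarrow> complex" where
  "tsin n x = (tchar n x - tchar (- n) x) / (2 * \<i>)"

lemma tcos_cos: "tcos n x = of_real (cos (2 * pi * (of_int_vec n \<bullet> x)))"
  by (simp add: tcos_def tchar_def of_int_vec_minus complex_eq_iff)

lemma tsin_sin: "tsin n x = of_real (sin (2 * pi * (of_int_vec n \<bullet> x)))"
  by (simp add: tsin_def tchar_def of_int_vec_minus complex_eq_iff Re_divide Im_divide power2_eq_square)

lemma norm_tcos_le: "norm (tcos n x) \<le> 1" and norm_tsin_le: "norm (tsin n x) \<le> 1"
  by (simp_all add: tcos_cos tsin_sin)

lemma tcos_lin: "tcos n x = 1 / 2 * tchar n x + 1 / 2 * tchar (- n) x"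
  by (simp add: tcos_def field_simps)

lemma tsin_lin: "tsin n x = 1 / (2 * \<i>) * tchar n x + (- 1 / (2 * \<i>)) * tchar (- n) x"
  by (simp add: tsin_def field_simps)

lemma trig_on_tcos: "n \<in> S \<Longrightarrow> - n \<in> S \<Longrightarrow> trig_on S (tcos n)"
  unfolding tcos_lin[abs_def] by (intro trig_on_add trig_on_cmult trig_on_tchar)

lemma trig_on_tsin: "n \<in> S \<Longrightarrow> - n \<in> S \<Longrightarrow> trig_on S (tsin n)"
  unfolding tsin_lin[abs_def] by (intro trig_on_add trig_on_cmult trig_on_tchar)

lemma partial_cmult:
  assumes "f differentiable (at x)"
  shows "partial j (\<lambda>x. c * f x) x = c * partial j f x"
proof -
  have "(\<lambda>x. 0 :: complex) differentiable (at x)" by simp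
  from partial_linear_comb[OF assms this, of j c] show ?thesis
    by (simp add: partialI[OF has_derivative_const])
qed

lemma partial_tchar_comb:
  "partial j (\<lambda>x. a * tchar m x + b * tchar n x) x = a * partial j (tchar m) x + b * partial j (tchar n) x"
proof -
  have "(\<lambda>x. b * tchar n x) differentiable (at x)"
    by (intro derivative_intros tchar_differentiable)
  from partial_linear_comb[OF tchar_differentiable this] show ?thesis
    by (simp only: partial_cmult[OF tchar_differentiable])
qed

lemma partial_tcos: "partial j (tcos n) x = - (2 * pi * of_int (n $ j)) * tsin n x"
  unfolding tcos_lin[abs_def] partial_tchar_comb
  by (simp add: partial_tchar tsin_lin field_simps)

lemma partial_tsin: "partial j (tsin n) x = 2 * pi * of_int (n $ j) * tcos n x"
  unfolding tsin_lin[abs_def] partial_tchar_comb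
  by (simp add: partial_tchar tcos_lin field_simps)

definition freq_ball :: "real \<Rightarrow> (int^'d) set" where
  "freq_ball \<rho> = {m. norm (of_int_vec m) \<le> \<rho>}"

text \<open>The 4 in \<open>growth\<close> separates spectra: it keeps the partial product before
  step \<open>k\<close> at frequencies of norm at most half that of \<open>\<nu> k\<close>. The
  \<open>M\<close> there and in \<open>direction\<close> serves the size of the error terms. All
  directions are compared with that of \<open>\<nu> 0\<close>, the single vector factored out of the
  gradient.\<close>

locale lacunary =
  fixes \<nu> :: "nat \<Rightarrow> int^'d" and M :: nat
  assumes M: "M \<ge> 1"
    and nonzero: "k < M \<Longrightarrow> \<nu> k \<noteq> 0"
    and growth: "Suc k < M \<Longrightarrow> 4 * real M * norm (of_int_vec (\<nu> k)) \<le> norm (of_int_vec (\<nu> (Suc k)))"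
    and direction: "k < M \<Longrightarrow>
      \<bar>of_int (\<nu> k $ j) / norm (of_int_vec (\<nu> k)) - of_int (\<nu> 0 $ j) / norm (of_int_vec (\<nu> 0))\<bar> \<le> 1 / real M"
begin

definition L :: "nat \<Rightarrow> real" where "L k = norm (of_int_vec (\<nu> k))"

primrec R :: "nat \<Rightarrow> real^'d \<Rightarrow> complex" where
  "R 0 = (\<lambda>x. 1)"
| "R (Suc k) = (\<lambda>x. R k x * (1 + tcos (\<nu> k) x))"

text \<open>
  The gradient of \<open>F M\<close> is, up to an \<open>L\<^sub>1\<close>-bounded error, the direction of \<open>\<nu> 0\<close> times
  \<open>\<Sum>k<M. cos(\<nu> k) R k = R M - 1\<close>.
\<close>

primrec F :: "nat \<Rightarrow> real^'d \<Rightarrow> complex" where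
  "F 0 = (\<lambda>x. 0)"
| "F (Suc k) = (\<lambda>x. (1 / complex_of_real (2 * pi * L k)) * (tsin (\<nu> k) x * R k x) + F k x)"

lemma L_ge_1: "k < M \<Longrightarrow> L k \<ge> 1"
  unfolding L_def by (intro norm_of_int_vec_ge_1 nonzero)

lemma L_pos: "k < M \<Longrightarrow> L k > 0"
  using L_ge_1 by fastforce

lemma L_Suc: "Suc k < M \<Longrightarrow> 4 * real M * L k \<le> L (Suc k)"
  unfolding L_def by (rule growth)

lemma L_Suc4: "Suc k < M \<Longrightarrow> 4 * L k \<le> L (Suc k)"
proof -
  assume a: "Suc k < M"
  have "4 * 1 * L k \<le> 4 * real M * L k"
    using M L_pos[of k] a by (intro mult_right_mono) auto
  thus ?thesis using L_Suc[OF a] by simp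
qed

lemma L_less: "i < k \<Longrightarrow> k < M \<Longrightarrow> 4 * L i \<le> L k"
proof (induction k)
  case (Suc k)
  show ?case
  proof (cases "i = k")
    case False
    hence "4 * L i \<le> L k" using Suc by auto
    thus ?thesis using L_Suc4[OF Suc.prems(2)] L_pos[of k] Suc.prems by linarith
  qed (use L_Suc4 Suc.prems in auto)
qed simp

lemma component_le_L: "\<bar>of_int (\<nu> k $ j)\<bar> \<le> L k"
  using component_le_norm_cart[of "of_int_vec (\<nu> k)" j] by (simp add: L_def)

lemma trig_on_R: "trig_on UNIV (R k)"
  by (induction k) (auto intro!: trig_on_const trig_on_UNIV_mult trig_on_add trig_on_tcos)

lemma trig_on_F: "trig_on UNIV (F k)"
proof (induction k)
  case (Suc k)
  thus ?case unfolding F.simps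
    by (intro trig_on_UNIV_mult trig_on_add trig_on_cmult trig_on_tsin trig_on_R) auto
qed (simp add: trig_on.zero)

text \<open>The induction closes because
  \<open>L k / 2 + L k \<le> 2 * L k \<le> L (Suc k) / 2\<close>.\<close>

lemma R_spectrum: "k < M \<Longrightarrow> trig_on (freq_ball (L k / 2)) (R k)"
proof (induction k)
  case 0
  show ?case using L_pos[of 0] 0 by (auto intro!: trig_on_const simp: freq_ball_def)
next
  case (Suc k)
  have 1: "trig_on (freq_ball (L k)) (\<lambda>x. 1 + tcos (\<nu> k) x)"
    using L_pos[of k] Suc.prems
    by (intro trig_on_add trig_on_const trig_on_tcos) (auto simp: freq_ball_def L_def of_int_vec_minus)
  have IH: "trig_on (freq_ball (L k / 2)) (R k)" using Suc by simp
  show ?case unfolding R.simps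
  proof (rule trig_on_mult[OF IH 1])
    fix a b :: "int^'d" assume "a \<in> freq_ball (L k / 2)" "b \<in> freq_ball (L k)"
    hence "norm (of_int_vec (a + b)) \<le> L k / 2 + L k"
      unfolding of_int_vec_add freq_ball_def by (intro norm_triangle_le) auto
    thus "a + b \<in> freq_ball (L (Suc k) / 2)"
      using L_Suc4[OF Suc.prems] L_pos[of k] Suc.prems by (auto simp: freq_ball_def)
  qed
qed

lemma fourier_R_outside:
  "k < M \<Longrightarrow> L k / 2 < norm (of_int_vec n) \<Longrightarrow> fourier_coeff (R k) n = 0"
  using fourier_coeff_outside[OF R_spectrum] by (auto simp: freq_ball_def)

lemma cont_R: "continuous_on UNIV (R k)"
  and cont_F: "continuous_on UNIV (F k)"
  and cont_pR: "continuous_on UNIV (partial j (R k))"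
  and cont_pF: "continuous_on UNIV (partial j (F k))"
  by (rule trig_on_continuous trig_on_R trig_on_F trig_on_partial)+

lemma diff_R: "R k differentiable (at x)" and diff_F: "F k differentiable (at x)"
  by (rule trig_on_differentiable trig_on_R trig_on_F)+

lemma cont_tcos: "continuous_on UNIV (tcos n)" and cont_tsin: "continuous_on UNIV (tsin n)"
  by (rule trig_on_continuous[of UNIV], rule trig_on_tcos trig_on_tsin, auto)+

lemma diff_tcos: "tcos n differentiable (at x)" and diff_tsin: "tsin n differentiable (at x)"
  by (rule trig_on_differentiable[of UNIV], rule trig_on_tcos trig_on_tsin, auto)+

lemma fourier_tcos_mult:
  assumes "continuous_on UNIV f"
  shows "fourier_coeff (\<lambda>x. tcos m x * f x) n = (fourier_coeff f (n - m) + fourier_coeff f (n + m)) / 2"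
proof -
  have "(\<lambda>x. tcos m x * f x) = (\<lambda>x. (1 / 2) * (tchar m x * f x) + (1 / 2) * (tchar (- m) x * f x))"
    by (auto simp: tcos_lin algebra_simps)
  hence "fourier_coeff (\<lambda>x. tcos m x * f x) n =
     1 / 2 * fourier_coeff (\<lambda>x. tchar m x * f x) n + fourier_coeff (\<lambda>x. (1 / 2) * (tchar (- m) x * f x)) n"
    by (simp only:) (intro fourier_coeff_linear_comb continuous_intros continuous_tchar assms)
  thus ?thesis unfolding fourier_coeff_cmult fourier_coeff_tchar_mult by (simp add: field_simps)
qed

lemma fourier_tsin_mult:
  assumes "continuous_on UNIV f"
  shows "fourier_coeff (\<lambda>x. tsin m x * f x) n = (fourier_coeff f (n - m) - fourier_coeff f (n + m)) / (2 * \<i>)"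
proof -
  have "(\<lambda>x. tsin m x * f x) = (\<lambda>x. (1 / (2 * \<i>)) * (tchar m x * f x) + (- 1 / (2 * \<i>)) * (tchar (- m) x * f x))"
    by (auto simp: tsin_lin algebra_simps)
  hence "fourier_coeff (\<lambda>x. tsin m x * f x) n =
     1 / (2 * \<i>) * fourier_coeff (\<lambda>x. tchar m x * f x) n + fourier_coeff (\<lambda>x. (- 1 / (2 * \<i>)) * (tchar (- m) x * f x)) n"
    by (simp only:) (intro fourier_coeff_linear_comb continuous_intros continuous_tchar assms)
  thus ?thesis unfolding fourier_coeff_cmult fourier_coeff_tchar_mult by (simp add: field_simps)
qed

text \<open>The new factor adds shifts of \<open>R k\<close> by \<open>\<nu> k\<close> and its
  negative; these reach the zero frequency only from frequencies of norm \<open>L k\<close>, outside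
  the spectrum of \<open>R k\<close>.\<close>

lemma fourier_R_0: "k \<le> M \<Longrightarrow> fourier_coeff (R k) 0 = 1"
proof (induction k)
  case 0
  show ?case by (simp add: fourier_coeff_def)
next
  case (Suc k)
  have "R (Suc k) = (\<lambda>x. R k x + tcos (\<nu> k) x * R k x)" by (auto simp: algebra_simps)
  hence "fourier_coeff (R (Suc k)) 0 = fourier_coeff (R k) 0 + fourier_coeff (\<lambda>x. tcos (\<nu> k) x * R k x) 0"
    by (simp only:) (intro fourier_coeff_add continuous_intros cont_R cont_tcos)
  moreover have "fourier_coeff (R k) (- \<nu> k) = 0" "fourier_coeff (R k) (\<nu> k) = 0"
    using Suc.prems L_pos[of k] by (auto intro!: fourier_R_outside simp: of_int_vec_minus L_def)
  ultimately show ?case using Suc by (simp add: fourier_tcos_mult cont_R)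
qed

lemma R_nonneg: "\<exists>r\<ge>0. R k x = complex_of_real r"
proof (induction k)
  case 0
  show ?case by (intro exI[of _ 1]) simp
next
  case (Suc k)
  then obtain r where r: "r \<ge> 0" "R k x = complex_of_real r" by blast
  have c: "0 \<le> 1 + cos (2 * pi * (of_int_vec (\<nu> k) \<bullet> x))"
    using cos_ge_minus_one[of "2 * pi * (of_int_vec (\<nu> k) \<bullet> x)"] by linarith
  show ?case
    by (rule exI[of _ "r * (1 + cos (2 * pi * (of_int_vec (\<nu> k) \<bullet> x)))"])
       (use r c in \<open>simp add: tcos_cos\<close>)
qed

text \<open>The product is nonnegative, so its L1 norm is its mean.\<close>

lemma integral_norm_R:
  assumes "k \<le> M"
  shows "(LINT x|torus. norm (R k x)) = 1"
proof -
  have "norm (R k x) = Re (R k x)" for x using R_nonneg[of k x] by auto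
  hence "(LINT x|torus. norm (R k x)) = (LINT x|torus. Re (R k x))" by simp
  also have "\<dots> = Re (LINT x|torus. R k x)"
    by (rule integral_Re[OF integrable_torus_continuous[OF cont_R]])
  also have "(LINT x|torus. R k x) = fourier_coeff (R k) 0"
    by (simp add: fourier_coeff_eq_tchar)
  finally show ?thesis using fourier_R_0[OF assms] by simp
qed

text \<open>The gain \<open>1 / M\<close> over the trivial size \<open>L k\<close> comes from the
  growth: one step yields at most \<open>2 * pi * L k\<close> plus twice the previous bound, in
  total at most \<open>4 * pi * L k\<close>, which is \<open>pi / M\<close> times
  \<open>4 * real M * L k\<close>.\<close>

lemma integral_partial_R: "k < M \<Longrightarrow> (LINT x|torus. norm (partial j (R k) x)) \<le> pi / M * L k"
proof (induction k)
  case 0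
  show ?case using L_pos[of 0] 0 by (simp add: partialI[OF has_derivative_const])
next
  case (Suc k)
  hence k: "k < M" by simp
  have d1: "(\<lambda>x. 1 + tcos (\<nu> k) x) differentiable (at x)" for x
    by (intro derivative_intros diff_tcos)
  have p1: "partial j (\<lambda>x. 1 + tcos (\<nu> k) x) x = partial j (tcos (\<nu> k)) x" for x
    using partial_linear_comb[OF _ diff_tcos, of "\<lambda>_. 1" x j 1 "\<nu> k"]
    by (simp add: partialI[OF has_derivative_const])
  have "norm (partial j (R (Suc k)) x) \<le> (2 * pi * L k) * norm (R k x) + 2 * norm (partial j (R k) x)" for x
  proof -
    have "partial j (R (Suc k)) x = R k x * partial j (tcos (\<nu> k)) x + partial j (R k) x * (1 + tcos (\<nu> k) x)"
      unfolding R.simps by (subst partial_mult[OF diff_R d1]) (simp add: p1)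
    also have "norm \<dots> \<le> norm (R k x) * (2 * pi * L k) + norm (partial j (R k) x) * 2"
    proof (intro norm_triangle_le add_mono)
      have "norm (partial j (tcos (\<nu> k)) x) \<le> (2 * pi * L k) * 1"
        unfolding partial_tcos norm_mult
        using component_le_L[of k j] by (intro mult_mono norm_tsin_le) (auto simp: norm_mult)
      thus "norm (R k x * partial j (tcos (\<nu> k)) x) \<le> norm (R k x) * (2 * pi * L k)"
        by (simp add: norm_mult mult_left_mono)
      have "norm (1 + tcos (\<nu> k) x) \<le> 2"
        using norm_triangle_ineq[of 1 "tcos (\<nu> k) x"] norm_tcos_le[of "\<nu> k" x] by simp
      thus "norm (partial j (R k) x * (1 + tcos (\<nu> k) x)) \<le> norm (partial j (R k) x) * 2"
        by (simp only: norm_mult mult_left_mono norm_ge_zero)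
    qed
    finally show ?thesis by (simp add: algebra_simps)
  qed
  hence "(LINT x|torus. norm (partial j (R (Suc k)) x)) \<le>
      (LINT x|torus. (2 * pi * L k) * norm (R k x) + 2 * norm (partial j (R k) x))"
    by (intro integral_torus_mono continuous_intros cont_R cont_pR)
  also have "\<dots> = (2 * pi * L k) * (LINT x|torus. norm (R k x)) + 2 * (LINT x|torus. norm (partial j (R k) x))"
    by (subst Bochner_Integration.integral_add)
       (auto intro!: integrable_torus_continuous continuous_intros cont_R cont_pR)
  also have "\<dots> \<le> (2 * pi * L k) * 1 + 2 * (pi / M * L k)"
    using Suc.IH[OF k] integral_norm_R[of k] k L_pos[OF k] by (intro add_mono mult_left_mono) auto
  \<comment> \<open>The gain in the old term is thrown away; the next growth factor restores
    it.\<close>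
  also have "\<dots> \<le> (2 * pi * L k) * 1 + 2 * (pi * L k)"
    using M L_pos[OF k] by (intro add_left_mono mult_left_mono mult_right_mono) (auto simp: field_simps)
  also have "\<dots> = pi / M * (4 * real M * L k)" using M by simp
  also have "\<dots> \<le> pi / M * L (Suc k)"
    by (rule mult_left_mono[OF L_Suc[OF Suc.prems]]) simp
  finally show ?case .
qed

lemma partial_F_Suc:
  assumes "k < M"
  shows "partial j (F (Suc k)) x =
    partial j (F k) x + complex_of_real (of_int (\<nu> k $ j) / L k) * (tcos (\<nu> k) x * R k x)
    + complex_of_real (1 / (2 * pi * L k)) * (tsin (\<nu> k) x * partial j (R k) x)"
proof -
  have d: "(\<lambda>x. tsin (\<nu> k) x * R k x) differentiable (at x)"
    by (intro derivative_intros diff_tsin diff_R)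
  show ?thesis unfolding F.simps
    using L_pos[OF assms]
    by (subst partial_linear_comb[OF d diff_F], subst partial_mult[OF diff_tsin diff_R])
       (simp add: partial_tsin field_simps)
qed

text \<open>The main terms telescope, because \<open>tcos (\<nu> k) x * R k x\<close> is
  \<open>R (Suc k) x - R k x\<close>. What remains at each step is the change of direction, at most
  \<open>1 / M\<close>, and the derivative falling on \<open>R k\<close>.\<close>

lemma partial_F_approx:
  "k \<le> M \<Longrightarrow> norm (partial j (F k) x - complex_of_real (of_int (\<nu> 0 $ j) / L 0) * (R k x - 1))
    \<le> (\<Sum>i<k. 1 / M * norm (R i x) + 1 / (2 * pi * L i) * norm (partial j (R i) x))"
proof (induction k)
  case 0
  show ?case by (simp add: partialI[OF has_derivative_const])
next
  case (Suc k)
  hence k: "k < M" by simp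
  let ?v = "complex_of_real (of_int (\<nu> 0 $ j) / L 0)" and ?u = "complex_of_real (of_int (\<nu> k $ j) / L k)"
  have alg: "(a + u * (c * r) + w) - v * (r * (1 + c) - 1) = (a - v * (r - 1)) + ((u - v) * (c * r) + w)"
    for a u c r w v :: complex by (simp add: algebra_simps)
  have eq: "partial j (F (Suc k)) x - ?v * (R (Suc k) x - 1) =
      (partial j (F k) x - ?v * (R k x - 1)) + ((?u - ?v) * (tcos (\<nu> k) x * R k x)
      + complex_of_real (1 / (2 * pi * L k)) * (tsin (\<nu> k) x * partial j (R k) x))"
    unfolding partial_F_Suc[OF k] R.simps by (rule alg)
  have 1: "norm ((?u - ?v) * (tcos (\<nu> k) x * R k x)) \<le> 1 / M * (1 * norm (R k x))"
    unfolding norm_mult of_real_diff[symmetric] norm_of_real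
    using direction[OF k, of j] by (intro mult_mono norm_tcos_le) (auto simp: L_def)
  have 2: "norm (complex_of_real (1 / (2 * pi * L k)) * (tsin (\<nu> k) x * partial j (R k) x)) \<le>
     1 / (2 * pi * L k) * (1 * norm (partial j (R k) x))"
    unfolding norm_mult norm_of_real using L_pos[OF k] by (intro mult_mono norm_tsin_le) auto
  show ?case unfolding eq sum.lessThan_Suc
    using Suc.IH k 1 2 by (intro norm_triangle_le add_mono) auto
qed

lemma integral_norm_partial_F: "(LINT x|torus. norm (partial j (F M) x)) \<le> 4"
proof -
  let ?v = "of_int (\<nu> 0 $ j) / L 0"
  have v: "\<bar>?v\<bar> \<le> 1" using component_le_L[of 0 j] L_pos[of 0] M by (simp add: field_simps)
  have "norm (partial j (F M) x) \<le> (norm (R M x) + 1) +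
    (\<Sum>i<M. 1 / M * norm (R i x) + 1 / (2 * pi * L i) * norm (partial j (R i) x))" for x
  proof -
    have "norm (complex_of_real ?v * (R M x - 1)) \<le> 1 * (norm (R M x) + 1)"
      unfolding norm_mult norm_of_real
      using v norm_triangle_ineq4[of "R M x" 1] by (intro mult_mono) auto
    hence 1: "norm (complex_of_real ?v * (R M x - 1)) \<le> norm (R M x) + 1" by (simp only: mult_1)
    show ?thesis
      by (rule order_trans[OF norm_triangle_sub add_mono[OF 1 partial_F_approx[OF order_refl]]])
  qed
  hence "(LINT x|torus. norm (partial j (F M) x)) \<le>
    (LINT x|torus. (norm (R M x) + 1) +
       (\<Sum>i<M. 1 / M * norm (R i x) + 1 / (2 * pi * L i) * norm (partial j (R i) x)))"
    using L_pos by (intro integral_torus_mono continuous_intros cont_R cont_pR cont_pF) fastforce+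
  also have "\<dots> = (LINT x|torus. norm (R M x) + 1) +
       (LINT x|torus. (\<Sum>i<M. 1 / M * norm (R i x) + 1 / (2 * pi * L i) * norm (partial j (R i) x)))"
    using L_pos
    by (intro Bochner_Integration.integral_add integrable_torus_continuous continuous_intros cont_R cont_pR) fastforce+
  also have "(LINT x|torus. norm (R M x) + 1) = (LINT x|torus. norm (R M x)) + (LINT x|(torus :: (real^'d) measure). 1)"
    by (intro Bochner_Integration.integral_add integrable_torus_continuous continuous_intros cont_R cont_pR)
  also have "\<dots> = 2" by (simp add: integral_norm_R)
  also have "(LINT x|torus. (\<Sum>i<M. 1 / M * norm (R i x) + 1 / (2 * pi * L i) * norm (partial j (R i) x))) =
     (\<Sum>i<M. LINT x|torus. 1 / M * norm (R i x) + 1 / (2 * pi * L i) * norm (partial j (R i) x))"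
    using L_pos
    by (intro Bochner_Integration.integral_sum integrable_torus_continuous continuous_intros cont_R cont_pR) fastforce+
  also have "\<dots> = (\<Sum>i<M. 1 / M * (LINT x|torus. norm (R i x)) + 1 / (2 * pi * L i) * (LINT x|torus. norm (partial j (R i) x)))"
    using L_pos by (intro sum.cong refl, subst Bochner_Integration.integral_add)
       (fastforce intro!: integrable_torus_continuous continuous_intros cont_R cont_pR)+
  also have "\<dots> \<le> (\<Sum>i<M. 1 / M * 1 + 1 / (2 * pi * L i) * (pi / M * L i))"
    using L_pos by (intro sum_mono add_mono mult_left_mono integral_partial_R) (auto simp: integral_norm_R less_imp_le)
  \<comment> \<open>Per term, \<open>1 / M\<close> stems from the change of direction and
    \<open>1 / (2 * M)\<close> from the derivative of \<open>R i\<close>; together with the 2 for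
    \<open>R M - 1\<close> the total is \<open>7 / 2\<close>.\<close>
  also have "\<dots> = (\<Sum>i<M. 3 / 2 / real M)"
  proof (intro sum.cong refl)
    fix i assume "i \<in> {..<M}"
    hence "L i > 0" by (intro L_pos) auto
    thus "1 / M * 1 + 1 / (2 * pi * L i) * (pi / M * L i) = 3 / 2 / real M" using M by (simp add: field_simps)
  qed
  also have "\<dots> = 3 / 2" using M by simp
  finally show ?thesis by simp
qed

text \<open>The first frequency contributes at most 1; every later one has norm at least
  \<open>M\<close>, so the others contribute at most \<open>1 / M\<close> each.\<close>

lemma integral_norm_F: "(LINT x|torus. norm (F M x)) \<le> 2"
proof -
  have "k \<le> M \<Longrightarrow> (LINT x|torus. norm (F k x)) \<le> (\<Sum>i<k. 1 / (2 * pi * L i))" for k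
  proof (induction k)
    case (Suc k)
    hence k: "k < M" by simp
    have "norm (F (Suc k) x) \<le> 1 / (2 * pi * L k) * norm (R k x) + norm (F k x)" for x
    proof -
      have "norm ((1 / complex_of_real (2 * pi * L k)) * (tsin (\<nu> k) x * R k x)) \<le>
         1 / (2 * pi * L k) * (1 * norm (R k x))"
        unfolding norm_mult using L_pos[OF k]
        by (intro mult_mono norm_tsin_le) (auto simp: norm_divide norm_mult)
      thus ?thesis unfolding F.simps by (intro norm_triangle_le) auto
    qed
    hence "(LINT x|torus. norm (F (Suc k) x)) \<le> (LINT x|torus. 1 / (2 * pi * L k) * norm (R k x) + norm (F k x))"
      using L_pos[OF k] by (intro integral_torus_mono continuous_intros cont_F cont_R) auto
    also have "\<dots> = 1 / (2 * pi * L k) * (LINT x|torus. norm (R k x)) + (LINT x|torus. norm (F k x))"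
      using L_pos[OF k] by (subst Bochner_Integration.integral_add)
         (auto intro!: integrable_torus_continuous continuous_intros cont_R cont_F)
    also have "\<dots> \<le> 1 / (2 * pi * L k) + (\<Sum>i<k. 1 / (2 * pi * L i))"
      using Suc.IH k by (simp add: integral_norm_R)
    finally show ?case by simp
  qed simp
  from this[OF order_refl] have "(LINT x|torus. norm (F M x)) \<le> (\<Sum>i<M. 1 / (2 * pi * L i))" .
  also have "\<dots> \<le> (\<Sum>i<M. (if i = 0 then 1 else 0) + 1 / M)"
  proof (intro sum_mono)
    fix i assume "i \<in> {..<M}"
    hence i: "i < M" by simp
    have "1 \<le> 2 * pi" using pi_ge_two by linarith
    hence le: "1 / (2 * pi * L i) \<le> 1 / L i"
      using L_pos[OF i] by (intro divide_left_mono) (auto simp: mult_le_cancel_right1)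
    show "1 / (2 * pi * L i) \<le> (if i = 0 then 1 else 0) + 1 / M"
    proof (cases i)
      case 0
      have "1 / L i \<le> 1" using L_ge_1[OF i] by simp
      thus ?thesis using le 0 by (simp add: add_increasing2)
    next
      case (Suc k)
      have "real M * 1 \<le> 4 * real M * L k" using L_ge_1[of k] i Suc by (intro mult_mono) auto
      also have "\<dots> \<le> L i" using L_Suc[of k] i Suc by simp
      finally have "real M \<le> L i" by simp
      hence "1 / L i \<le> 1 / M" using M by (intro divide_left_mono) auto
      thus ?thesis using le Suc by simp
    qed
  qed
  also have "\<dots> = 2" using M by (simp add: sum.distrib)
  finally show ?thesis .
qed

text \<open>Step \<open>K\<close> sees only frequencies within \<open>L K / 2\<close> of
  \<open>\<nu> K\<close> or its negative. By the growth, \<open>\<nu> k\<close> is that close only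
  for \<open>k = K\<close>, and there just the mean of \<open>R K\<close> is picked up, so later
  steps do not disturb the coefficient.\<close>

lemma fourier_F:
  "K \<le> M \<Longrightarrow> k < M \<Longrightarrow> fourier_coeff (F K) (\<nu> k) = (if k < K then 1 / (4 * pi * \<i> * L k) else 0)"
proof (induction K)
  case 0
  show ?case by (simp add: fourier_coeff_def)
next
  case (Suc K)
  hence K: "K < M" by simp
  have "fourier_coeff (F (Suc K)) (\<nu> k) =
     1 / complex_of_real (2 * pi * L K) * fourier_coeff (\<lambda>x. tsin (\<nu> K) x * R K x) (\<nu> k) + fourier_coeff (F K) (\<nu> k)"
    unfolding F.simps by (intro fourier_coeff_linear_comb continuous_intros cont_R cont_F cont_tsin)
  also have "fourier_coeff (\<lambda>x. tsin (\<nu> K) x * R K x) (\<nu> k) = (if k = K then 1 / (2 * \<i>) else 0)"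
  proof (cases "k = K")
    case True
    have "norm (of_int_vec (\<nu> K + \<nu> K)) = 2 * L K"
      unfolding of_int_vec_add scaleR_2[symmetric] L_def by simp
    hence "fourier_coeff (R K) (\<nu> K + \<nu> K) = 0"
      using L_pos[OF K] by (intro fourier_R_outside K) linarith
    thus ?thesis using True fourier_R_0[of K] K by (simp add: fourier_tsin_mult cont_R)
  next
    case False
    have far: "\<bar>L k - L K\<bar> > L K / 2"
      using False L_less[of k K] L_less[of K k] K Suc.prems L_pos[OF K] L_pos[OF Suc.prems(2)]
      by (cases "k < K") (auto simp: not_less)
    have "\<bar>L k - L K\<bar> \<le> norm (of_int_vec (\<nu> k - \<nu> K))"
      unfolding L_def of_int_vec_diff by (rule norm_triangle_ineq3)
    moreover have "\<bar>L k - L K\<bar> \<le> norm (of_int_vec (\<nu> k + \<nu> K))"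
      using norm_triangle_ineq3[of "of_int_vec (\<nu> k)" "- of_int_vec (\<nu> K)"]
      unfolding L_def of_int_vec_add by simp
    ultimately have "fourier_coeff (R K) (\<nu> k - \<nu> K) = 0" "fourier_coeff (R K) (\<nu> k + \<nu> K) = 0"
      using far by (auto intro!: fourier_R_outside K)
    thus ?thesis using False by (simp add: fourier_tsin_mult cont_R)
  qed
  finally show ?case using Suc K by (auto simp: less_Suc_eq field_simps)
qed

lemma inj_nu: "inj_on \<nu> {..<M}"
proof (rule inj_onI)
  fix i k assume ik: "i \<in> {..<M}" "k \<in> {..<M}" "\<nu> i = \<nu> k"
  hence "L i = L k" by (simp add: L_def)
  thus "i = k" using L_less[of i k] L_less[of k i] L_pos[of i] L_pos[of k] ik
    by (cases i k rule: linorder_cases) auto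
qed

lemma riesz_test_function:
  "trig_on UNIV (F M)" "W11_norm (F M) \<le> 2 + 4 * CARD('d)"
  "k < M \<Longrightarrow> norm (fourier_coeff (F M) (\<nu> k)) = 1 / (4 * pi * norm (of_int_vec (\<nu> k)))"
proof -
  show "trig_on UNIV (F M)" by (rule trig_on_F)
  have "W11_norm (F M) \<le> 2 + (\<Sum>j\<in>(UNIV :: 'd set). 4)"
    unfolding W11_norm_trig[OF trig_on_F] by (intro add_mono sum_mono integral_norm_F integral_norm_partial_F)
  thus "W11_norm (F M) \<le> 2 + 4 * CARD('d)" by simp
  show "norm (fourier_coeff (F M) (\<nu> k)) = 1 / (4 * pi * norm (of_int_vec (\<nu> k)))" if "k < M"
    using that fourier_F[of M k] by (simp add: norm_divide norm_mult L_def)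
qed

end

subsection \<open>Counting frequencies\<close>

lemma card_le_fibres:
  assumes "finite F" "finite B" "f ` F \<subseteq> B" "\<And>b. b \<in> B \<Longrightarrow> real (card {x \<in> F. f x = b}) \<le> c"
  shows "real (card F) \<le> real (card B) * c"
proof -
  have "real (card F) = (\<Sum>x\<in>F. 1)" by simp
  also have "\<dots> = (\<Sum>b\<in>B. \<Sum>x\<in>{x \<in> F. f x = b}. 1)"
    by (rule sum.group[OF assms(1-3), symmetric])
  also have "\<dots> \<le> (\<Sum>b\<in>B. c)" by (intro sum_mono) (use assms(4) in simp)
  finally show ?thesis by simp
qed

text \<open>Dyadic layers: about \<open>2 powr (k * \<sigma>)\<close> indices have
  \<open>a n\<close> of size \<open>2 powr (- k)\<close>, so the layers sum to a geometric series
  with ratio \<open>2 powr (\<sigma> - s) < 1\<close>.\<close>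

lemma summable_from_level_counts:
  fixes a :: "'a \<Rightarrow> real"
  assumes \<sigma>: "\<sigma> < s" and s: "0 < s" and C: "0 \<le> C"
    and a: "\<And>n. n \<in> S \<Longrightarrow> 0 \<le> a n" "\<And>n. n \<in> S \<Longrightarrow> a n \<le> B"
    and count: "\<And>t F. 0 < t \<Longrightarrow> t \<le> 1 \<Longrightarrow> finite F \<Longrightarrow> F \<subseteq> S \<Longrightarrow> (\<And>n. n \<in> F \<Longrightarrow> t \<le> a n) \<Longrightarrow>
        real (card F) \<le> C * t powr (- \<sigma>)"
  shows "(\<lambda>n. a n powr s) summable_on S"
proof (rule nonneg_bdd_above_summable_on)
  \<comment> \<open>The 2 covers rounding within a dyadic layer; \<open>B\<close> covers layer 0,
    which also receives all values above 1.\<close>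
  define B' where "B' = max 2 B"
  define \<rho> where "\<rho> = 2 powr (\<sigma> - s)"
  have "2 powr (\<sigma> - s) < 2 powr (0::real)" using \<sigma> by (intro powr_less_mono) auto
  hence \<rho>: "0 < \<rho>" "\<rho> < 1" by (auto simp: \<rho>_def)
  show "bdd_above (sum (\<lambda>n. a n powr s) ` {F. F \<subseteq> S \<and> finite F})"
  proof (rule bdd_aboveI2[where M = "C * B' powr s * (1 / (1 - \<rho>))"])
    fix F assume "F \<in> {F. F \<subseteq> S \<and> finite F}"
    hence FS: "F \<subseteq> S" "finite F" by auto
    \<comment> \<open>Vanishing terms have no dyadic layer and contribute nothing to the
      sum.\<close>
    define F' where "F' = {n \<in> F. a n > 0}"
    have F': "F' \<subseteq> S" "finite F'" "\<And>n. n \<in> F' \<Longrightarrow> a n > 0" using FS by (auto simp: F'_def)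
    \<comment> \<open>The truncation by \<open>nat\<close> puts every value of at least 1 into layer
      0.\<close>
    define m where "m n = nat \<lceil>- log 2 (a n)\<rceil>" for n
    have lo: "2 powr (- real (m n)) \<le> a n" if "n \<in> F'" for n
    proof -
      have "- log 2 (a n) \<le> real (m n)" unfolding m_def by linarith
      hence "- real (m n) \<le> log 2 (a n)" by simp
      hence "2 powr (- real (m n)) \<le> 2 powr (log 2 (a n))" by simp
      thus ?thesis using F'(3)[OF that] by simp
    qed
    have hi: "a n \<le> B' * 2 powr (- real (m n))" if "n \<in> F'" for n
    proof (cases "m n = 0")
      case True
      thus ?thesis using a(2)[of n] F'(1) that by (auto simp: B'_def)
    next
      case False
      hence "real (m n) \<le> - log 2 (a n) + 1" unfolding m_def by linarith
      hence "log 2 (a n) \<le> 1 + (- real (m n))" by simp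
      hence "2 powr (log 2 (a n)) \<le> 2 powr (1 + (- real (m n)))" by (intro powr_mono) auto
      also have "\<dots> = 2 * 2 powr (- real (m n))" by (subst powr_add) simp
      also have "\<dots> \<le> B' * 2 powr (- real (m n))" by (intro mult_right_mono) (auto simp: B'_def)
      finally show ?thesis using F'(3)[OF that] by simp
    qed
    define N where "N = Suc (Max (m ` F'))"
    have mN: "m ` F' \<subseteq> {..<N}"
      using F'(2) by (auto simp: N_def less_Suc_eq_le)
    have fib: "(\<Sum>n\<in>{n \<in> F'. m n = k}. a n powr s) \<le> C * B' powr s * \<rho> ^ k" for k
    proof -
      have "(\<Sum>n\<in>{n \<in> F'. m n = k}. a n powr s) \<le> (\<Sum>n\<in>{n \<in> F'. m n = k}. (B' * 2 powr (- real k)) powr s)"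
        using F'(3) hi s by (intro sum_mono powr_mono2) (auto intro: less_imp_le)
      also have "\<dots> = real (card {n \<in> F'. m n = k}) * (B' powr s * 2 powr (- real k * s))"
        by (simp add: powr_mult powr_powr B'_def)
      also have "\<dots> \<le> (C * (2 powr (- real k)) powr (- \<sigma>)) * (B' powr s * 2 powr (- real k * s))"
      proof (intro mult_right_mono count)
        show "2 powr - real k \<le> (1::real)" using powr_mono[of "- real k" 0 2] by simp
        show "2 powr - real k \<le> a n" if "n \<in> {n \<in> F'. m n = k}" for n using lo[of n] that by auto
      qed (use F' in auto)
      also have "\<dots> = C * B' powr s * (2 powr (real k * \<sigma>) * 2 powr (- real k * s))"
        by (simp add: powr_powr)
      also have "2 powr (real k * \<sigma>) * 2 powr (- real k * s) = (2 powr (\<sigma> - s)) powr real k"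
        unfolding powr_add[symmetric] powr_powr by (simp add: algebra_simps)
      also have "\<dots> = \<rho> ^ k" by (simp add: \<rho>_def powr_realpow)
      finally show ?thesis .
    qed
    have "(\<Sum>n\<in>F. a n powr s) = (\<Sum>n\<in>F'. a n powr s)"
      using FS a(1) by (intro sum.mono_neutral_right) (force simp: F'_def)+
    also have "\<dots> = (\<Sum>k<N. \<Sum>n\<in>{n \<in> F'. m n = k}. a n powr s)"
      by (rule sum.group[symmetric]) (use F' mN in auto)
    also have "\<dots> \<le> (\<Sum>k<N. C * B' powr s * \<rho> ^ k)" by (intro sum_mono fib)
    also have "\<dots> = C * B' powr s * (\<Sum>k<N. \<rho> ^ k)" by (simp add: sum_distrib_left)
    also have "\<dots> \<le> C * B' powr s * (\<Sum>k. \<rho> ^ k)"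
      using \<rho> C by (intro mult_left_mono sum_le_suminf summable_geometric) auto
    also have "(\<Sum>k. \<rho> ^ k) = 1 / (1 - \<rho>)" using \<rho> by (intro suminf_geometric) auto
    finally show "(\<Sum>n\<in>F. a n powr s) \<le> C * B' powr s * (1 / (1 - \<rho>))" .
  qed
qed simp

section \<open>Multipliers that satisfy a weak-type bound on trigonometric polynomials\<close>

lemma W11_norm_trig_nonneg: "trig_on S f \<Longrightarrow> 0 \<le> W11_norm f"
  by (simp add: W11_norm_trig sum_nonneg)

text \<open>This is all that is kept of the operator: its boundedness combined with weak-type
  Hausdorff-Young, tested on trigonometric polynomials.\<close>

locale weak_type_multiplier =
  fixes lam :: "int^'d \<Rightarrow> complex" and K q :: real
  assumes q: "q > 0" and K: "K > 0"
    and weak_type: "\<lbrakk>trig_on UNIV f; finite A; s > 0;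
        \<And>n. n \<in> A \<Longrightarrow> s \<le> norm (lam n) * norm (fourier_coeff f n)\<rbrakk>
      \<Longrightarrow> real (card A) \<le> (K * W11_norm f / s) powr q"
begin

lemma weak_type_le:
  assumes "trig_on UNIV f" "finite A" "s > 0" "W11_norm f \<le> W"
    "\<And>n. n \<in> A \<Longrightarrow> s \<le> norm (lam n) * norm (fourier_coeff f n)"
  shows "real (card A) \<le> (K * W / s) powr q"
proof -
  have "real (card A) \<le> (K * W11_norm f / s) powr q"
    by (rule weak_type[OF assms(1,2,3,5)])
  also have "\<dots> \<le> (K * W / s) powr q"
    using assms q K W11_norm_trig_nonneg[OF assms(1)]
    by (intro powr_mono2 divide_right_mono mult_left_mono) auto
  finally show ?thesis .
qed

text \<open>The norm constant of \<open>cube_test_function\<close> times \<open>K\<close>; the extra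
  2 is the ratio between the radius of the cube and the smallest norm in a dyadic shell.\<close>

definition C1 :: real where "C1 = 2 * K * (2 ^ CARD('d) * (1 + CARD('d) * (1 + 10 * pi\<^sup>2)))"

text \<open>The norm bound of the Riesz primitive times \<open>K\<close>, divided by the
  \<open>1 / (4 * pi)\<close> in its coefficients.\<close>

definition C2 :: real where "C2 = K * (2 + 4 * CARD('d)) * (4 * pi)"

lemma C1_pos: "C1 > 0" and C2_pos: "C2 > 0"
proof -
  have "0 \<le> real CARD('d) * (1 + 10 * pi\<^sup>2)" by simp
  hence "0 < 1 + real CARD('d) * (1 + 10 * pi\<^sup>2)" by linarith
  thus "C1 > 0" unfolding C1_def using K by (intro mult_pos_pos) auto
  show "C2 > 0" unfolding C2_def using K by (intro mult_pos_pos) auto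
qed

definition level :: "int^'d \<Rightarrow> nat" where
  "level n = nat \<lfloor>log 2 (norm (of_int_vec n))\<rfloor>"

lemma level_bounds:
  assumes "n \<noteq> 0"
  shows "2 ^ level n \<le> norm (of_int_vec n)" "norm (of_int_vec n) < 2 * 2 ^ level n"
proof -
  let ?x = "norm (of_int_vec n)"
  have x: "?x \<ge> 1" by (rule norm_of_int_vec_ge_1[OF assms])
  hence l0: "0 \<le> log 2 ?x" by (subst zero_le_log_cancel_iff) linarith+
  hence l: "real (level n) \<le> log 2 ?x" "log 2 ?x < real (level n) + 1"
    unfolding level_def by linarith+
  have e: "2 powr (log 2 ?x) = ?x" using x by (intro powr_log_cancel) linarith+
  have "2 powr (real (level n)) \<le> 2 powr (log 2 ?x)" using l by simp
  thus "2 ^ level n \<le> ?x" unfolding e by (simp add: powr_realpow)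
  have "2 powr (log 2 ?x) < 2 powr (real (level n) + 1)" using l by simp
  thus "?x < 2 * 2 ^ level n" unfolding e by (simp add: powr_add powr_realpow)
qed

text \<open>The scale cancels: the kernel that is 1 on the shell has norm of order
  \<open>2 ^ l\<close>, and \<open>lam\<close> is at least \<open>t * 2 ^ l\<close> there.\<close>

lemma level_count:
  assumes t: "t > 0" and F: "finite F" "0 \<notin> F"
    and big: "\<And>n. n \<in> F \<Longrightarrow> t * norm (of_int_vec n) \<le> norm (lam n)"
    and lev: "\<And>n. n \<in> F \<Longrightarrow> level n = l"
  shows "real (card F) \<le> (C1 / t) powr q"
proof -
  define R :: nat where "R = 2 * 2 ^ l"
  have R: "R \<ge> 1" by (simp add: R_def)
  define c where "c = (2::real) ^ CARD('d) * (1 + CARD('d) * (1 + 10 * pi\<^sup>2))"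
  obtain f :: "real^'d \<Rightarrow> complex" where f: "trig_on UNIV f" "\<And>n. n \<in> cube R \<Longrightarrow> fourier_coeff f n = 1"
      "W11_norm f \<le> c * R"
    using cube_test_function[OF R, where 'd = 'd] unfolding c_def by blast
  have "real (card F) \<le> (K * (c * R) / (t / 2 * R)) powr q"
  proof (rule weak_type_le[OF f(1) F(1) _ f(3)])
    show "0 < t / 2 * R" using t R by simp
    fix n assume n: "n \<in> F"
    hence n0: "n \<noteq> 0" using F by auto
    note lb = level_bounds[OF n0, unfolded lev[OF n]]
    have "n \<in> cube R" unfolding cube_def
    proof (intro CollectI allI)
      fix i
      have "\<bar>real_of_int (n $ i)\<bar> \<le> norm (of_int_vec n)"
        using component_le_norm_cart[of "of_int_vec n" i] by simp
      also have "\<dots> \<le> real R" using lb(2) by (simp add: R_def)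
      finally show "\<bar>n $ i\<bar> \<le> int R" by linarith
    qed
    moreover have "t / 2 * R \<le> norm (lam n)"
    proof -
      have "t / 2 * R = t * 2 ^ l" by (simp add: R_def)
      also have "\<dots> \<le> t * norm (of_int_vec n)" using lb(1) t by (intro mult_left_mono) auto
      also have "\<dots> \<le> norm (lam n)" by (rule big[OF n])
      finally show ?thesis .
    qed
    ultimately show "t / 2 * R \<le> norm (lam n) * norm (fourier_coeff f n)" using f(2) by simp
  qed
  also have "K * (c * R) / (t / 2 * R) = C1 / t"
    using R t unfolding C1_def c_def[symmetric] by (simp add: field_simps)
  finally show ?thesis .
qed

text \<open>The coefficients of the test function decay like the inverse norm of the frequency,
  which exactly offsets the growth of \<open>lam\<close>; hence the sizes of the frequencies drop
  out.\<close>

lemma lacunary_count: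
  assumes "lacunary \<nu> M" and t: "t > 0"
    and big: "\<And>k. k < M \<Longrightarrow> t * norm (of_int_vec (\<nu> k)) \<le> norm (lam (\<nu> k))"
  shows "real M \<le> (C2 / t) powr q"
proof -
  interpret lacunary \<nu> M by fact
  have "real (card (\<nu> ` {..<M})) \<le> (K * (2 + 4 * CARD('d)) / (t / (4 * pi))) powr q"
  proof (rule weak_type_le[OF riesz_test_function(1)])
    show "W11_norm (F M) \<le> 2 + 4 * CARD('d)" using riesz_test_function(2) by simp
    fix n assume "n \<in> \<nu> ` {..<M}"
    then obtain k where k: "k < M" "n = \<nu> k" by auto
    have "t / (4 * pi) = (t * L k) * (1 / (4 * pi * L k))" using L_pos[OF k(1)] by simp
    also have "\<dots> \<le> norm (lam n) * (1 / (4 * pi * L k))"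
      using big[OF k(1)] L_pos[OF k(1)] k by (intro mult_right_mono) (auto simp: L_def)
    also have "1 / (4 * pi * L k) = norm (fourier_coeff (F M) n)"
      using riesz_test_function(3)[OF k(1)] k by (simp add: L_def)
    finally show "t / (4 * pi) \<le> norm (lam n) * norm (fourier_coeff (F M) n)" .
  qed (use t in auto)
  also have "K * (2 + 4 * CARD('d)) / (t / (4 * pi)) = C2 / t" by (simp add: C2_def)
  finally show ?thesis by (simp add: card_image[OF inj_nu])
qed

text \<open>
  Frequencies are sorted by their direction up to \<open>1 / M\<close> and by their dyadic level modulo \<open>l\<close>.
  Within one class, representatives of distinct levels form a lacunary sequence.
\<close>

definition cell :: "nat \<Rightarrow> int^'d \<Rightarrow> int^'d" where
  "cell M n = (\<chi> j. \<lfloor>real M * (of_int (n $ j) / norm (of_int_vec n))\<rfloor>)"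

lemma cell_in_cube:
  assumes "n \<noteq> 0"
  shows "cell M n \<in> cube M"
  unfolding cube_def
proof (intro CollectI allI)
  fix j
  let ?u = "of_int (n $ j) / norm (of_int_vec n)"
  have "\<bar>real_of_int (n $ j)\<bar> \<le> norm (of_int_vec n)"
    using component_le_norm_cart[of "of_int_vec n" j] by simp
  hence "\<bar>?u\<bar> \<le> 1" using assms by simp
  hence "\<bar>real M * ?u\<bar> \<le> real M * 1" unfolding abs_mult by (intro mult_mono) auto
  hence "real M * ?u \<le> real M" "- (real M * ?u) \<le> real M"
    by (simp_all only: mult_1_right abs_le_iff)
  hence "- int M \<le> \<lfloor>real M * ?u\<rfloor>" "\<lfloor>real M * ?u\<rfloor> \<le> int M" by linarith+
  thus "\<bar>cell M n $ j\<bar> \<le> int M" by (simp add: cell_def)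
qed

lemma cell_eq_imp_close:
  assumes "cell M m = cell M n" "M \<ge> 1"
  shows "\<bar>of_int (m $ j) / norm (of_int_vec m) - of_int (n $ j) / norm (of_int_vec n)\<bar> \<le> 1 / real M"
proof -
  let ?u = "of_int (m $ j) / norm (of_int_vec m)" and ?v = "of_int (n $ j) / norm (of_int_vec n)"
  have "\<lfloor>real M * ?u\<rfloor> = \<lfloor>real M * ?v\<rfloor>"
    using assms(1) by (simp add: cell_def vec_eq_iff)
  hence "\<bar>real M * ?u - real M * ?v\<bar> \<le> 1" by linarith
  hence "real M * \<bar>?u - ?v\<bar> \<le> 1"
    by (simp only: right_diff_distrib[symmetric] abs_mult abs_of_nat)
  thus ?thesis using assms(2) by (simp add: field_simps)
qed

text \<open>With more than \<open>M\<close> levels, the lowest \<open>M\<close> of them, one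
  representative each, would form a lacunary sequence too long for \<open>lacunary_count\<close>:
  levels that agree modulo \<open>l\<close> differ by at least \<open>l\<close>, and a common cell
  means nearby directions.\<close>

lemma class_level_count:
  assumes t: "t > 0" and G: "finite G" "0 \<notin> G"
    and big: "\<And>n. n \<in> G \<Longrightarrow> t * norm (of_int_vec n) \<le> norm (lam n)"
    and M: "M \<ge> 1" "(C2 / t) powr q < real M" and l: "8 * real M \<le> 2 ^ l"
    and same: "\<And>m n. m \<in> G \<Longrightarrow> n \<in> G \<Longrightarrow> level m mod l = level n mod l \<and> cell M m = cell M n"
  shows "card (level ` G) \<le> M"
proof (rule ccontr)
  assume "\<not> card (level ` G) \<le> M"
  define xs where "xs = sorted_list_of_set (level ` G)"
  have len: "M < length xs" using \<open>\<not> card (level ` G) \<le> M\<close> by (simp add: xs_def)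
  have setxs: "set xs = level ` G" using G by (simp add: xs_def)
  have sor: "sorted_wrt (<) xs" by (simp add: xs_def)
  have "\<exists>n\<in>G. level n = xs ! k" if "k < M" for k
    using setxs that len nth_mem[of k xs] by force
  then obtain \<nu> where \<nu>: "\<And>k. k < M \<Longrightarrow> \<nu> k \<in> G" "\<And>k. k < M \<Longrightarrow> level (\<nu> k) = xs ! k"
    by metis
  have nz: "\<nu> k \<noteq> 0" if "k < M" for k using \<nu>(1)[OF that] G by metis
  have "lacunary \<nu> M"
  proof
    fix k assume k: "Suc k < M"
    hence k': "k < M" by simp
    have "xs ! k < xs ! Suc k" using sor k len by (auto simp: sorted_wrt_iff_nth_less)
    moreover have "xs ! k mod l = xs ! Suc k mod l"
      using same[OF \<nu>(1)[OF k'] \<nu>(1)[OF k]] \<nu>(2)[OF k'] \<nu>(2)[OF k] by simp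
    ultimately have "l dvd xs ! Suc k - xs ! k"
      by (metis less_imp_le_nat mod_eq_dvd_iff_nat)
    hence ge: "xs ! k + l \<le> xs ! Suc k"
      using \<open>xs ! k < xs ! Suc k\<close> by (auto dest!: dvd_imp_le)
    \<comment> \<open>Within a shell norms vary by a factor of up to 2; this turns the required
      growth \<open>4 M\<close> into the condition \<open>8 * real M \<le> 2 ^ l\<close>.\<close>
    have "4 * real M * norm (of_int_vec (\<nu> k)) \<le> 4 * real M * (2 * 2 ^ (xs ! k))"
      using level_bounds(2)[OF nz[OF k']] \<nu>(2)[OF k'] by (intro mult_left_mono) auto
    also have "\<dots> = 8 * real M * 2 ^ (xs ! k)" by simp
    also have "\<dots> \<le> 2 ^ l * 2 ^ (xs ! k)" by (intro mult_right_mono l) simp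
    also have "\<dots> = 2 ^ (xs ! k + l)" by (simp add: power_add)
    also have "\<dots> \<le> 2 ^ (xs ! Suc k)" using ge by (intro power_increasing) auto
    also have "\<dots> \<le> norm (of_int_vec (\<nu> (Suc k)))"
      using level_bounds(1)[OF nz[OF k]] \<nu>(2)[OF k] by simp
    finally show "4 * real M * norm (of_int_vec (\<nu> k)) \<le> norm (of_int_vec (\<nu> (Suc k)))" .
  next
    fix k j assume k: "k < M"
    show "\<bar>of_int (\<nu> k $ j) / norm (of_int_vec (\<nu> k)) - of_int (\<nu> 0 $ j) / norm (of_int_vec (\<nu> 0))\<bar> \<le> 1 / real M"
      using same[OF \<nu>(1)[OF k] \<nu>(1)[of 0]] M by (intro cell_eq_imp_close) auto
  qed (use M nz in auto)
  from lacunary_count[OF this t big[OF \<nu>(1)]] M(2) show False by simp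
qed

text \<open>Number of classes, times levels per class, times frequencies per level.\<close>

lemma card_superlevel_le:
  assumes t: "t > 0" and F: "finite F" "0 \<notin> F"
    and big: "\<And>n. n \<in> F \<Longrightarrow> t * norm (of_int_vec n) \<le> norm (lam n)"
    and M: "M \<ge> 1" "(C2 / t) powr q < real M" and l: "l \<ge> 1" "8 * real M \<le> 2 ^ l"
  shows "real (card F) \<le> (real l * (2 * real M + 1) ^ CARD('d)) * (real M * (C1 / t) powr q)"
proof -
  let ?B = "{..<l} \<times> (cube M :: (int^'d) set)"
  have "real (card F) \<le> real (card ?B) * (real M * (C1 / t) powr q)"
  proof (rule card_le_fibres[where f = "\<lambda>n. (level n mod l, cell M n)"])
    show "(\<lambda>n. (level n mod l, cell M n)) ` F \<subseteq> ?B"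
      using F(2) l(1) by (auto intro!: cell_in_cube)
    fix b assume "b \<in> ?B"
    define G where "G = {n \<in> F. (level n mod l, cell M n) = b}"
    have G: "finite G" "0 \<notin> G" "G \<subseteq> F" using F by (auto simp: G_def)
    have "card (level ` G) \<le> M"
      by (rule class_level_count[OF t G(1,2) _ M l(2)]) (use G(3) big in \<open>auto simp: G_def\<close>)
    moreover have "real (card G) \<le> real (card (level ` G)) * (C1 / t) powr q"
    proof (rule card_le_fibres[where f = level])
      fix k
      show "real (card {n \<in> G. level n = k}) \<le> (C1 / t) powr q"
        by (rule level_count[OF t, where l = k]) (use G big in auto)
    qed (use G in auto)
    ultimately show "real (card {n \<in> F. (level n mod l, cell M n) = b}) \<le> real M * (C1 / t) powr q"
      unfolding G_def[symmetric] by (meson mult_right_mono of_nat_mono order_trans powr_ge_zero)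
  qed (use F finite_cube in auto)
  also have "real (card ?B) = real l * (2 * real M + 1) ^ CARD('d)"
    by (simp add: card_cartesian_product card_cube add.commute)
  finally show ?thesis .
qed

text \<open>A single frequency with ratio above \<open>C1\<close> would already contradict
  \<open>level_count\<close>, as the bound there would be below 1.\<close>

lemma ratio_bounded:
  assumes "n \<noteq> 0"
  shows "norm (lam n) / norm (of_int_vec n) \<le> C1"
proof (rule ccontr)
  let ?t = "norm (lam n) / norm (of_int_vec n)"
  assume *: "\<not> ?t \<le> C1"
  hence t: "?t > 0" using C1_pos by linarith
  have t1: "C1 / ?t < 1" using * t by (subst divide_less_eq_1_pos) auto
  have "real (card {n}) \<le> (C1 / ?t) powr q"
    by (rule level_count[OF t, where l = "level n"]) (use assms in auto)
  moreover have "(C1 / ?t) powr q < 1 powr q"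
    using t t1 q C1_pos by (intro powr_less_mono2) auto
  ultimately show False by simp
qed

text \<open>In \<open>card_superlevel_le\<close>, \<open>M\<close> is taken of order
  \<open>y = t powr (- q)\<close> and \<open>l\<close> of order \<open>log M\<close>, which is at
  most a constant times \<open>y powr \<delta>\<close>; all factors then become powers of
  \<open>y\<close>.\<close>

lemma card_superlevel_powr:
  assumes \<delta>: "\<delta> > 0"
  shows "\<exists>C\<ge>0. \<forall>t F. 0 < t \<longrightarrow> t \<le> 1 \<longrightarrow> finite F \<longrightarrow> 0 \<notin> F \<longrightarrow>
      (\<forall>n\<in>F. t * norm (of_int_vec n) \<le> norm (lam n)) \<longrightarrow>
      real (card F) \<le> C * t powr (- (q * (real CARD('d) + 2 + \<delta>)))"
proof -
  define c where "c = C2 powr q + 2"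
  have c: "c \<ge> 1" by (simp add: c_def add_increasing)
  define C where "C = ((16 * c) powr \<delta> / (\<delta> * ln 2)) * (3 * c) ^ CARD('d) * c * C1 powr q"
  have "C \<ge> 0" using c \<delta> by (simp add: C_def)
  moreover have "real (card F) \<le> C * t powr (- (q * (real CARD('d) + 2 + \<delta>)))"
    if t: "0 < t" "t \<le> 1" and F: "finite F" "0 \<notin> F"
      and big: "\<And>n. n \<in> F \<Longrightarrow> t * norm (of_int_vec n) \<le> norm (lam n)" for t F
  proof -
    define y where "y = t powr (- q)"
    have "t powr 0 \<le> t powr (- q)" using t q by (intro powr_mono') auto
    hence y: "y \<ge> 1" using t by (simp add: y_def)
    have pw: "(b / t) powr q = b powr q * y" if "b \<ge> 0" for b
      using t that unfolding y_def powr_minus by (simp add: powr_divide divide_inverse[symmetric])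
    define M where "M = nat \<lfloor>(C2 / t) powr q\<rfloor> + 1"
    have M1: "M \<ge> 1" by (simp add: M_def)
    have M2: "(C2 / t) powr q < real M" unfolding M_def by linarith
    have M3: "real M \<le> c * y"
    proof -
      have "0 \<le> (C2 / t) powr q" by simp
      hence "real M \<le> (C2 / t) powr q + 1" unfolding M_def by linarith
      also have "\<dots> = C2 powr q * y + 1" using C2_pos by (simp add: pw)
      also have "\<dots> \<le> c * y" using y by (simp add: c_def algebra_simps)
      finally show ?thesis .
    qed
    define l where "l = nat \<lceil>log 2 (8 * real M)\<rceil>"
    have log1: "1 \<le> log 2 (8 * real M)"
      using M1 by (subst le_log_iff) auto
    hence l1: "l \<ge> 1" unfolding l_def by linarith
    have l2: "8 * real M \<le> 2 ^ l"
    proof -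
      have "8 * real M = 2 powr (log 2 (8 * real M))" using M1 by simp
      also have "\<dots> \<le> 2 powr (real l)" unfolding l_def by (intro powr_mono real_nat_ceiling_ge) auto
      finally show ?thesis by (simp add: powr_realpow)
    qed
    have l3: "real l \<le> (16 * c) powr \<delta> / (\<delta> * ln 2) * y powr \<delta>"
    proof -
      have "real l \<le> log 2 (8 * real M) + 1" using log1 unfolding l_def by linarith
      \<comment> \<open>The doubling of 8 to 16 absorbs the 1 lost in rounding up.\<close>
      also have "\<dots> = log 2 (16 * real M)"
        using M1 log_mult[of 2 "8 * real M" 2] by (simp add: mult.commute)
      also have "\<dots> = ln (16 * real M) / ln 2" by (simp add: log_def)
      also have "\<dots> \<le> ((16 * real M) powr \<delta> / \<delta>) / ln 2"
        using M1 \<delta> by (intro divide_right_mono ln_powr_bound) auto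
      also have "\<dots> \<le> ((16 * (c * y)) powr \<delta> / \<delta>) / ln 2"
        using M3 \<delta> by (intro divide_right_mono powr_mono2 mult_left_mono) auto
      also have "\<dots> = (16 * c) powr \<delta> / (\<delta> * ln 2) * y powr \<delta>"
        using c y powr_mult[of "16 * c" y \<delta>] by (simp add: mult.assoc)
      finally show ?thesis .
    qed
    have "2 * real M + 1 \<le> 3 * c * y" using M1 M3 by linarith
    hence d3: "(2 * real M + 1) ^ CARD('d) \<le> (3 * c * y) ^ CARD('d)" by (intro power_mono) auto
    have nn: "0 \<le> c * y" "0 \<le> (16 * c) powr \<delta> / (\<delta> * ln 2) * y powr \<delta>" using c y \<delta> by auto
    have "real (card F) \<le> (real l * (2 * real M + 1) ^ CARD('d)) * (real M * (C1 / t) powr q)"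
      by (rule card_superlevel_le[OF t(1) F big M1 M2 l1 l2])
    also have "\<dots> \<le> (((16 * c) powr \<delta> / (\<delta> * ln 2) * y powr \<delta>) * (3 * c * y) ^ CARD('d)) * ((c * y) * (C1 / t) powr q)"
      using M3 l3 d3 nn c y \<delta> by (intro mult_mono mult_nonneg_nonneg) auto
    also have "\<dots> = C * (y powr \<delta> * y ^ CARD('d) * y * y)"
      using C1_pos by (simp add: pw C_def power_mult_distrib)
    \<comment> \<open>The factors belong, in order, to the residues of levels, the direction cells,
      the levels in a class and the frequencies in a level.\<close>
    also have "y powr \<delta> * y ^ CARD('d) * y * y = y powr (\<delta> + CARD('d) + 1 + 1)"
      using y by (simp add: powr_add powr_realpow power2_eq_square)
    also have "\<dots> = t powr (- (q * (real CARD('d) + 2 + \<delta>)))"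
      unfolding y_def powr_powr by (simp add: algebra_simps)
    finally show ?thesis .
  qed
  ultimately show ?thesis by blast
qed

lemma ratio_powr_summable_on:
  assumes "\<epsilon> > 0"
  shows "(\<lambda>n. (norm (lam n) / norm (of_int_vec n)) powr (q * (real CARD('d) + 2) + \<epsilon>)) summable_on (UNIV - {0})"
proof -
  \<comment> \<open>Half of \<open>\<epsilon>\<close> pays for the logarithm; the other half gives
    the strict gap between the counting exponent and the summation exponent.\<close>
  define \<delta> where "\<delta> = \<epsilon> / (2 * q)"
  have \<delta>: "\<delta> > 0" using assms q by (simp add: \<delta>_def)
  have qd: "q * \<delta> = \<epsilon> / 2" using q by (simp add: \<delta>_def)
  obtain C where C: "C \<ge> 0" "\<And>t F. \<lbrakk>0 < t; t \<le> 1; finite F; 0 \<notin> F;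
      \<forall>n\<in>F. t * norm (of_int_vec n) \<le> norm (lam n)\<rbrakk> \<Longrightarrow>
      real (card F) \<le> C * t powr (- (q * (real CARD('d) + 2 + \<delta>)))"
    using card_superlevel_powr[OF \<delta>] by blast
  show ?thesis
  proof (rule summable_from_level_counts[where \<sigma> = "q * (real CARD('d) + 2 + \<delta>)" and C = C and B = C1])
    show "q * (real CARD('d) + 2 + \<delta>) < q * (real CARD('d) + 2) + \<epsilon>"
      using assms qd by (simp add: algebra_simps)
    show "0 < q * (real CARD('d) + 2) + \<epsilon>" using q assms by (intro add_pos_pos mult_pos_pos) auto
    fix t :: real and F :: "(int^'d) set"
    assume t: "0 < t" "t \<le> 1" and F: "finite F" "F \<subseteq> UNIV - {0}"
      and big: "\<And>n. n \<in> F \<Longrightarrow> t \<le> norm (lam n) / norm (of_int_vec n)"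
    have "t * norm (of_int_vec n) \<le> norm (lam n)" if n: "n \<in> F" for n
    proof -
      have "norm (of_int_vec n) \<ge> 1" using F(2) n by (intro norm_of_int_vec_ge_1) auto
      hence "0 < norm (of_int_vec n)" by linarith
      thus ?thesis using big[OF n] by (simp only: pos_le_divide_eq)
    qed
    thus "real (card F) \<le> C * t powr - (q * (real CARD('d) + 2 + \<delta>))"
      using F by (intro C(2) t) auto
  qed (use C(1) ratio_bounded in auto)
qed

end

section \<open>From the operator to a weak-type multiplier\<close>

theorem theorem3:
  fixes T :: "(real ^ 'd \<Rightarrow> complex) \<Rightarrow> (real ^ 'd \<Rightarrow> complex)"
    and lam :: "int ^ 'd \<Rightarrow> complex"
    and p \<epsilon> :: real
  assumes "1 < p" and "p \<le> 2"
    and "bounded_linear_W11_Lp p T"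
    and "translation_invariant T"
    and "\<And>f n. f \<in> W11 \<Longrightarrow> fourier_coeff (T f) n = lam n * fourier_coeff f n"
    and "\<epsilon> > 0"
  shows "(\<lambda>n. (norm (lam n) / norm (of_int_vec n))
            powr (p / (p - 1) + p / (p - 1) * (real CARD('d) + 1) + \<epsilon>))
         summable_on (UNIV - {0})"
proof -
  obtain C where C: "\<And>f. f \<in> W11 \<Longrightarrow> Lp_norm p (T f) \<le> C * W11_norm f"
    using assms(3) unfolding bounded_linear_W11_Lp_def by blast
  have Lp: "T f \<in> Lp p" if "f \<in> W11" for f
    using assms(3) that unfolding bounded_linear_W11_Lp_def by blast
  define q where "q = p / (p - 1)"
  \<comment> \<open>The operator bound \<open>C\<close> need not be positive, whereas the locale
    asks for a positive constant; hence \<open>max 1 C\<close>.\<close>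
  interpret weak_type_multiplier lam "max 1 C" q
  proof
    show qpos: "q > 0" using assms(1) by (simp add: q_def)
    fix f :: "real^'d \<Rightarrow> complex" and A :: "(int^'d) set" and s :: real
    assume f: "trig_on UNIV f" and A: "finite A" and s: "s > 0"
      and big: "\<And>n. n \<in> A \<Longrightarrow> s \<le> norm (lam n) * norm (fourier_coeff f n)"
    have fW: "f \<in> W11" by (rule trig_on_W11[OF f])
    have "real (card A) \<le> (Lp_norm p (T f) / s) powr q"
      unfolding q_def
      by (rule weak_hausdorff_young[OF assms(1,2) Lp[OF fW] A s])
         (simp add: assms(5)[OF fW] norm_mult big)
    also have "\<dots> \<le> (max 1 C * W11_norm f / s) powr q"
    proof (intro powr_mono2 divide_right_mono)
      show "Lp_norm p (T f) \<le> max 1 C * W11_norm f"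
        by (rule order_trans[OF C[OF fW] mult_right_mono[OF max.cobounded2 W11_norm_trig_nonneg[OF f]]])
      show "0 \<le> Lp_norm p (T f) / s" using s by (simp add: Lp_norm_def)
    qed (use s qpos in auto)
    finally show "real (card A) \<le> (max 1 C * W11_norm f / s) powr q" .
  qed simp
  have "q * (real CARD('d) + 2) + \<epsilon> = p / (p - 1) + p / (p - 1) * (real CARD('d) + 1) + \<epsilon>"
    by (simp add: q_def[symmetric] algebra_simps)
  thus ?thesis using ratio_powr_summable_on[OF assms(6)] by simp
qed

end
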